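(* Let $u\in H^2$, and let $\Gamma_u$ be the Hankel operator $\Gamma_u f=\mathbb{P}(u\cdot Jf)$ defined on the maximal domain $\operatorname{Dom}\Gamma_u=\{f\in H^2:\ \Gamma_u f\in H^2\}$. Then: (i) $\Gamma_u$ is closed, i.e. $\operatorname{Dom}\Gamma_u$ is closed (complete) with respect to the graph norm $\|f\|_{\Gamma_u}=(\|f\|_{H^2}^2+\|\Gamma_u f\|_{H^2}^2)^{1/2}$; (ii) the set of all polynomials in $z$ is dense in $\operatorname{Dom}\Gamma_u$ with respect to the graph norm; (iii) the adjoint of $\Gamma_u$ is given by $\Gamma_u^*=\Gamma_{u^\#}$ (including equality of domains), where $\Gamma_{u^\#}$ is defined in the same way on its maximal domain, with $u$ replaced by $u^\#$.
   Context: $H^2$ is the standard Hardy space on the unit circle $\mathbb{T}$ (with normalised Lebesgue measure), and $\mathbb{P}$ is the orthogonal projection from $L^2(\mathbb{T})$ onto $H^2$. For a function $f$ on $\mathbb{T}$, $Jf(z)=f(\overline z)$. For $f\in H^2$, $f^\#\in H^2$ is $f^\#(z)=\overline{f(\overline z)}$, i.e. all Fourier coefficients are replaced by their complex conjugates. For $u,f\in H^2$ the product $h=u\cdot Jf$ is in $L^1(\mathbb{T})$; the condition $\Gamma_u f\in H^2$ means that the Fourier coefficients $\widehat h_n$ with $n\ge 0$ are square-summable, and then $\Gamma_u f=\mathbb{P}(uJf)=\sum_{n\ge0}\widehat h_n z^n\in H^2$ (that is, $\mathbb{P}$ is taken in the sense of distributions). The operator $\Gamma_u$ may be unbounded. 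*)

theory Defs
  imports "HOL-Probability.Probability" "HOL-Computational_Algebra.Polynomial"
begin

text \<open>
  Elements of \<open>L\<^sup>2\<close> and \<open>H\<^sup>2\<close> of the unit circle are represented by functions, and
  equality of elements is equality almost everywhere.  Only the values on the circle matter,
  since the underlying measure space is the circle itself.
\<close>

definition circle_measure :: "complex measure" where
  "circle_measure =
     distr (uniform_measure lborel {0..2*pi}) (restrict_space borel (sphere 0 1)) cis"

lemma space_circle_measure [simp]: "space circle_measure = sphere 0 1"
  by (simp add: circle_measure_def space_restrict_space)

lemma prob_space_circle_measure: "prob_space circle_measure"
proof -
  interpret prob_space "uniform_measure lborel {0..2*pi}"
    by (rule prob_space_uniform_measure) auto
  have "cis \<in> borel_measurable borel"
    by (intro borel_measurable_continuous_onI continuous_intros)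
  hence "cis \<in> uniform_measure lborel {0..2*pi} \<rightarrow>\<^sub>M restrict_space borel (sphere 0 1)"
    by (intro measurable_restrict_space2) auto
  thus ?thesis
    unfolding circle_measure_def by (rule prob_space_distr)
qed

definition L2 :: "(complex \<Rightarrow> complex) set" where
  "L2 = {f. f \<in> borel_measurable circle_measure \<and>
            integrable circle_measure (\<lambda>z. (norm (f z))\<^sup>2)}"

definition L2_inner :: "(complex \<Rightarrow> complex) \<Rightarrow> (complex \<Rightarrow> complex) \<Rightarrow> complex" where
  "L2_inner f g = (LINT z|circle_measure. f z * cnj (g z))"

definition L2_norm :: "(complex \<Rightarrow> complex) \<Rightarrow> real" where
  "L2_norm f = sqrt (LINT z|circle_measure. (norm (f z))\<^sup>2)"

definition fourier_coeff :: "(complex \<Rightarrow> complex) \<Rightarrow> int \<Rightarrow> complex" where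
  "fourier_coeff f n = (LINT z|circle_measure. f z * z powi (- n))"

definition H2 :: "(complex \<Rightarrow> complex) set" where
  "H2 = {f \<in> L2. \<forall>n<0. fourier_coeff f n = 0}"

definition refl_J :: "(complex \<Rightarrow> complex) \<Rightarrow> complex \<Rightarrow> complex" where
  "refl_J f z = f (cnj z)"

definition sharp :: "(complex \<Rightarrow> complex) \<Rightarrow> complex \<Rightarrow> complex" where
  "sharp f z = cnj (f (cnj z))"

text \<open>
  The projection onto \<open>H\<^sup>2\<close> in the sense of distributions, for integrable \<open>h\<close> whose Fourier
  coefficients of nonnegative index are square-summable: the sum in \<open>L\<^sup>2\<close> of the analytic part
  of the Fourier series.  For \<open>h\<close> in \<open>L\<^sup>2\<close> it is the orthogonal projection.  The value is
  determined up to equality almost everywhere, and it is unspecified if the series does not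
  converge.
\<close>

definition hardy_proj :: "(complex \<Rightarrow> complex) \<Rightarrow> complex \<Rightarrow> complex" where
  "hardy_proj h = (SOME g. g \<in> H2 \<and>
     (\<lambda>N. L2_norm (\<lambda>z. g z - (\<Sum>n<N. fourier_coeff h (int n) * z ^ n))) \<longlonglongrightarrow> 0)"

definition hankel :: "(complex \<Rightarrow> complex) \<Rightarrow> (complex \<Rightarrow> complex) \<Rightarrow> complex \<Rightarrow> complex" where
  "hankel u f = hardy_proj (\<lambda>z. u z * refl_J f z)"

definition hankel_dom :: "(complex \<Rightarrow> complex) \<Rightarrow> (complex \<Rightarrow> complex) set" where
  "hankel_dom u = {f \<in> H2.
     summable (\<lambda>n. (norm (fourier_coeff (\<lambda>z. u z * refl_J f z) (int n)))\<^sup>2)}"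

text \<open>
  A possibly unbounded operator in \<open>H\<^sup>2\<close> is given by its domain \<open>D\<close> and a map \<open>T\<close>; the values
  of \<open>T\<close> outside \<open>D\<close> are irrelevant.
\<close>

definition graph_norm ::
  "((complex \<Rightarrow> complex) \<Rightarrow> complex \<Rightarrow> complex) \<Rightarrow> (complex \<Rightarrow> complex) \<Rightarrow> real" where
  "graph_norm T f = sqrt ((L2_norm f)\<^sup>2 + (L2_norm (T f))\<^sup>2)"

definition closed_operator ::
  "(complex \<Rightarrow> complex) set \<Rightarrow> ((complex \<Rightarrow> complex) \<Rightarrow> complex \<Rightarrow> complex) \<Rightarrow> bool" where
  "closed_operator D T \<longleftrightarrow>
     (\<forall>F f g. (\<forall>n. F n \<in> D) \<and> f \<in> H2 \<and> g \<in> H2 \<and>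
        (\<lambda>n::nat. L2_norm (\<lambda>z. F n z - f z)) \<longlonglongrightarrow> 0 \<and>
        (\<lambda>n. L2_norm (\<lambda>z. T (F n) z - g z)) \<longlonglongrightarrow> 0 \<longrightarrow>
        f \<in> D \<and> (AE z in circle_measure. T f z = g z))"

definition graph_norm_complete ::
  "(complex \<Rightarrow> complex) set \<Rightarrow> ((complex \<Rightarrow> complex) \<Rightarrow> complex \<Rightarrow> complex) \<Rightarrow> bool" where
  "graph_norm_complete D T \<longleftrightarrow>
     (\<forall>F. (\<forall>n. F n \<in> D) \<and>
        (\<forall>e>0. \<exists>N::nat. \<forall>m\<ge>N. \<forall>n\<ge>N. graph_norm T (\<lambda>z. F m z - F n z) < e) \<longrightarrow>
        (\<exists>f\<in>D. (\<lambda>n. graph_norm T (\<lambda>z. F n z - f z)) \<longlonglongrightarrow> 0))"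

text \<open>
  The adjoint.  If \<open>D\<close> is dense in \<open>H\<^sup>2\<close>, the function \<open>w\<close> below is determined by \<open>g\<close> up to
  equality almost everywhere.
\<close>

definition adjoint_dom ::
  "(complex \<Rightarrow> complex) set \<Rightarrow> ((complex \<Rightarrow> complex) \<Rightarrow> complex \<Rightarrow> complex)
     \<Rightarrow> (complex \<Rightarrow> complex) set" where
  "adjoint_dom D T =
     {g \<in> H2. \<exists>w\<in>H2. \<forall>f\<in>D. L2_inner (T f) g = L2_inner f w}"

definition adjoint_op ::
  "(complex \<Rightarrow> complex) set \<Rightarrow> ((complex \<Rightarrow> complex) \<Rightarrow> complex \<Rightarrow> complex)
     \<Rightarrow> (complex \<Rightarrow> complex) \<Rightarrow> complex \<Rightarrow> complex" where
  "adjoint_op D T g = (SOME w. w \<in> H2 \<and> (\<forall>f\<in>D. L2_inner (T f) g = L2_inner f w))"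

end

theory Submission
  imports Defs
begin

text \<open>
  For \<open>n \<ge> 0\<close> the coefficient of index \<open>n\<close> of \<open>u \<cdot> Jf\<close> is \<open>\<Sum>k. a (n + k) * f k\<close>, where \<open>a\<close> are
  the coefficients of \<open>u\<close>.  It depends continuously on \<open>f\<close> in the \<open>L\<^sup>2\<close> norm, because \<open>u\<close> lies
  in \<open>L\<^sup>2\<close>.  Hence a limit of points of the graph of \<open>\<Gamma>\<^sub>u\<close> lies again on the graph, and the
  operator is closed.

  For polynomials \<open>p\<close> the pairing \<open>\<langle>\<Gamma>\<^sub>u p, g\<rangle>\<close> is a finite combination of the coefficients that
  define \<open>\<Gamma>\<close> of \<open>u\<^sup>#\<close> at \<open>g\<close>.  So the adjoint of the restriction of \<open>\<Gamma>\<^sub>u\<close> to the polynomials is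
  \<open>\<Gamma>\<close> of \<open>u\<^sup>#\<close> on its maximal domain, and the statement about \<open>\<Gamma>\<^sub>u\<^sup>*\<close> follows once the
  polynomials are known to be dense in the graph norm.  This density is the heart of the matter:
  it says that two conditionally convergent double sums may be interchanged, and truncating the
  Fourier series of \<open>f\<close> gives no control of \<open>\<Gamma>\<^sub>u\<close>.

  Put \<open>v = Ju\<close>.  Given \<open>f\<close> in the domain, choose a bounded analytic \<open>\<psi>\<close>, close to 1, for which
  \<open>v * \<psi>\<close> is bounded as well.  Three facts then lead from \<open>f\<close> to a polynomial.
  \<^item> \<open>\<Gamma>\<^sub>u (\<psi> * f)\<close> is the analytic part of \<open>J\<psi> * \<Gamma>\<^sub>u f\<close> (lemma \<open>hankel_mult\<close>), so \<open>\<psi> * f\<close> tends to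
    \<open>f\<close> in the graph norm when \<open>\<psi>\<close> tends to 1 boundedly.
  \<^item> The operator \<open>f \<mapsto> \<Gamma>\<^sub>u (\<psi> * f)\<close> is bounded, since its symbol \<open>u * J\<psi>\<close> is.  So \<open>f\<close> may be
    replaced by a polynomial \<open>r\<close> in the factor \<open>\<psi> * f\<close>.
  \<^item> There are polynomials \<open>q\<close> such that \<open>q\<close> and \<open>v * q\<close> approach \<open>\<psi>\<close> and \<open>v * \<psi>\<close> in \<open>L\<^sup>2\<close>, and
    then \<open>q * r\<close> approaches \<open>\<psi> * r\<close> in the graph norm.

  The multiplier \<open>\<psi>\<close> would usually be an outer function with prescribed modulus.  Here it is the
  solution of Szego's extremal problem: minimise \<open>\<integral> |p|\<^sup>2 * w\<close> over polynomials with \<open>p 0 = 1\<close> for the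
  weight \<open>w = 1 + \<epsilon> * |v|\<^sup>2\<close>.  Comparing the minimiser \<open>\<psi>\<close> with \<open>(1 - c * z ^ n) * \<psi>\<close> shows that all
  Fourier coefficients of \<open>|\<psi>|\<^sup>2 * w\<close> of nonzero index vanish.  Hence \<open>|\<psi>|\<^sup>2 * w\<close> is a constant, at
  most \<open>\<integral> w\<close>, which bounds both \<open>\<psi>\<close> and \<open>v * \<psi>\<close>; and \<open>\<psi>\<close> is close to 1 in \<open>L\<^sup>2\<close> because it has
  mean 1 and norm close to 1 (theorems \<open>extremal_function\<close> and \<open>outer_multiplier\<close>).  As a limit of
  polynomials in \<open>L\<^sup>2(w)\<close>, it comes with the polynomials \<open>q\<close> of the third fact.
\<close>

section \<open>The space of square-integrable functions on the circle\<close>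

abbreviation "\<mu> \<equiv> circle_measure"

interpretation circle: prob_space circle_measure
  by (rule prob_space_circle_measure)

lemma sets_circle_measure [measurable_cong]:
  "sets \<mu> = sets (restrict_space borel (sphere 0 1))"
  by (simp add: circle_measure_def)

lemma borel_measurable_circle:
  assumes "f \<in> borel_measurable borel"
  shows "f \<in> borel_measurable \<mu>"
  using measurable_restrict_space1[OF assms] measurable_cong_sets[OF sets_circle_measure refl] by blast

lemma measurable_circle_ident [measurable]: "(\<lambda>z. z) \<in> borel_measurable \<mu>"
  by (rule borel_measurable_circle) simp

lemma measurable_circle_cnj [measurable]: "cnj \<in> measurable \<mu> \<mu>"
proof -
  have "cnj \<in> borel_measurable borel"
    by (intro borel_measurable_continuous_onI continuous_intros)
  hence "cnj \<in> measurable (restrict_space borel (sphere 0 1)) (restrict_space borel (sphere 0 1))"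
    by (intro measurable_restrict_space3) (auto simp: measurable_def)
  thus ?thesis
    using measurable_cong_sets[OF sets_circle_measure sets_circle_measure] by blast
qed

lemma borel_measurable_cnj_circle [measurable (raw)]:
  "f \<in> borel_measurable M \<Longrightarrow> (\<lambda>z. cnj (f z)) \<in> borel_measurable M"
  by (rule borel_measurable_continuous_on[of cnj]) (auto intro: continuous_intros)

lemma AE_norm_circle: "AE z in \<mu>. norm z = 1"
  by (rule AE_I2) auto

lemma L2_measurable [measurable_dest]: "f \<in> L2 \<Longrightarrow> f \<in> borel_measurable \<mu>"
  by (simp add: L2_def)

lemma L2_integrable_sq: "f \<in> L2 \<Longrightarrow> integrable \<mu> (\<lambda>z. (norm (f z))\<^sup>2)"
  by (simp add: L2_def)

lemma norm_mult_le_sum_squares: "norm (a * b) \<le> (norm a)\<^sup>2 + (norm (b::complex))\<^sup>2"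
proof -
  have "2 * (norm a * norm b) \<le> (norm a)\<^sup>2 + (norm b)\<^sup>2"
    using sum_squares_bound[of "norm a" "norm b"] by (simp add: mult.assoc)
  moreover have "0 \<le> norm a * norm b" by simp
  ultimately show ?thesis unfolding norm_mult by linarith
qed

lemma L2_mult_integrable:
  assumes "f \<in> L2" "g \<in> L2"
  shows "integrable \<mu> (\<lambda>z. f z * g z)"
proof (rule Bochner_Integration.integrable_bound)
  show "integrable \<mu> (\<lambda>z. (norm (f z))\<^sup>2 + (norm (g z))\<^sup>2)"
    using assms by (intro Bochner_Integration.integrable_add L2_integrable_sq)
  show "(\<lambda>z. f z * g z) \<in> borel_measurable \<mu>"
    using assms[THEN L2_measurable] by measurable
  have "norm (f z * g z) \<le> norm ((norm (f z))\<^sup>2 + (norm (g z))\<^sup>2)" for z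
    using norm_mult_le_sum_squares[of "f z" "g z"] by (simp add: abs_of_nonneg)
  thus "AE z in \<mu>. norm (f z * g z) \<le> norm ((norm (f z))\<^sup>2 + (norm (g z))\<^sup>2)"
    by auto
qed

lemma L2_bound:
  assumes "g \<in> L2" "f \<in> borel_measurable \<mu>" "AE z in \<mu>. norm (f z) \<le> C * norm (g z)"
  shows "f \<in> L2"
proof -
  have "integrable \<mu> (\<lambda>z. (norm (f z))\<^sup>2)"
  proof (rule Bochner_Integration.integrable_bound)
    show "integrable \<mu> (\<lambda>z. C\<^sup>2 * (norm (g z))\<^sup>2)"
      using L2_integrable_sq[OF assms(1)] by simp
    show "AE z in \<mu>. norm ((norm (f z))\<^sup>2) \<le> norm (C\<^sup>2 * (norm (g z))\<^sup>2)"
      using assms(3)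
    proof eventually_elim
      case (elim z)
      hence "(norm (f z))\<^sup>2 \<le> (C * norm (g z))\<^sup>2"
        by (intro power_mono) auto
      thus ?case by (simp add: power_mult_distrib)
    qed
  qed (use assms(2) in measurable)
  thus ?thesis using assms(2) by (simp add: L2_def)
qed

lemma L2_add:
  assumes "f \<in> L2" "g \<in> L2"
  shows "(\<lambda>z. f z + g z) \<in> L2"
proof -
  have "integrable \<mu> (\<lambda>z. (norm (f z + g z))\<^sup>2)"
  proof (rule Bochner_Integration.integrable_bound)
    show "integrable \<mu> (\<lambda>z. 2 * (norm (f z))\<^sup>2 + 2 * (norm (g z))\<^sup>2)"
      using assms by (intro Bochner_Integration.integrable_add integrable_mult_right L2_integrable_sq)
    show "(\<lambda>z. (norm (f z + g z))\<^sup>2) \<in> borel_measurable \<mu>"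
      using assms[THEN L2_measurable] by measurable
    have "(norm (f z + g z))\<^sup>2 \<le> 2 * (norm (f z))\<^sup>2 + 2 * (norm (g z))\<^sup>2" for z
    proof -
      have "(norm (f z + g z))\<^sup>2 \<le> (norm (f z) + norm (g z))\<^sup>2"
        by (intro power_mono norm_triangle_ineq) auto
      also have "\<dots> \<le> 2 * (norm (f z))\<^sup>2 + 2 * (norm (g z))\<^sup>2"
        using sum_squares_bound[of "norm (f z)" "norm (g z)"] by (simp add: power2_sum)
      finally show ?thesis .
    qed
    thus "AE z in \<mu>. norm ((norm (f z + g z))\<^sup>2)
        \<le> norm (2 * (norm (f z))\<^sup>2 + 2 * (norm (g z))\<^sup>2)"
      by (simp add: abs_of_nonneg)
  qed
  thus ?thesis using assms by (auto simp: L2_def)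
qed

lemma L2_cmult: "f \<in> L2 \<Longrightarrow> (\<lambda>z. c * f z) \<in> L2"
  by (rule L2_bound[of f _ "norm c"]) (auto simp: norm_mult intro: borel_measurable_times L2_measurable)

lemma L2_diff: "f \<in> L2 \<Longrightarrow> g \<in> L2 \<Longrightarrow> (\<lambda>z. f z - g z) \<in> L2"
  using L2_add[of f "\<lambda>z. (-1) * g z"] L2_cmult[of g "-1"] by simp

lemma L2_const: "(\<lambda>z. c) \<in> L2"
  by (simp add: L2_def)

lemma L2_sum: "(\<And>i. i \<in> A \<Longrightarrow> f i \<in> L2) \<Longrightarrow> (\<lambda>z. \<Sum>i\<in>A. f i z) \<in> L2"
  by (induction A rule: infinite_finite_induct) (auto intro: L2_add L2_const)

lemma L2_cnj: "f \<in> L2 \<Longrightarrow> (\<lambda>z. cnj (f z)) \<in> L2"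
  by (rule L2_bound[of f _ 1]) auto

lemma L2_bounded:
  assumes "f \<in> borel_measurable \<mu>" "AE z in \<mu>. norm (f z) \<le> C"
  shows "f \<in> L2"
  using L2_bound[of "\<lambda>_. 1" f C] L2_const assms by simp

lemma L2_bounded_mult:
  assumes "b \<in> borel_measurable \<mu>" "AE z in \<mu>. norm (b z) \<le> C" "f \<in> L2"
  shows "(\<lambda>z. b z * f z) \<in> L2"
proof (rule L2_bound[OF assms(3)])
  show "(\<lambda>z. b z * f z) \<in> borel_measurable \<mu>"
    using assms(1) L2_measurable[OF assms(3)] by measurable
  show "AE z in \<mu>. norm (b z * f z) \<le> C * norm (f z)"
    using assms(2) by eventually_elim (simp add: norm_mult mult_right_mono)
qed

lemma L2_integrable: "f \<in> L2 \<Longrightarrow> integrable \<mu> f"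
  using L2_mult_integrable[OF _ L2_const[of 1], of f] by simp

lemma L2_norm_nonneg [simp]: "0 \<le> L2_norm f"
  by (simp add: L2_norm_def)

lemma L2_norm_sq: "(L2_norm f)\<^sup>2 = (LINT z|\<mu>. (norm (f z))\<^sup>2)"
  by (simp add: L2_norm_def)

lemma L2_norm_cong:
  "(AE z in \<mu>. norm (f z) = norm (g z)) \<Longrightarrow> f \<in> borel_measurable \<mu> \<Longrightarrow> g \<in> borel_measurable \<mu>
    \<Longrightarrow> L2_norm f = L2_norm g"
  unfolding L2_norm_def by (intro arg_cong[of _ _ sqrt] integral_cong_AE) auto

lemma L2_norm_minus_commute: "L2_norm (\<lambda>z. f z - g z) = L2_norm (\<lambda>z. g z - f z)"
  unfolding L2_norm_def by (simp add: norm_minus_commute)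

lemma L2_norm_mono:
  assumes "g \<in> L2" "f \<in> borel_measurable \<mu>" "C \<ge> 0" "AE z in \<mu>. norm (f z) \<le> C * norm (g z)"
  shows "L2_norm f \<le> C * L2_norm g"
proof -
  have f: "f \<in> L2" by (rule L2_bound[OF assms(1,2,4)])
  have "(LINT z|\<mu>. (norm (f z))\<^sup>2) \<le> (LINT z|\<mu>. C\<^sup>2 * (norm (g z))\<^sup>2)"
  proof (rule integral_mono_AE)
    show "AE z in \<mu>. (norm (f z))\<^sup>2 \<le> C\<^sup>2 * (norm (g z))\<^sup>2"
      using assms(4)
    proof eventually_elim
      case (elim z)
      hence "(norm (f z))\<^sup>2 \<le> (C * norm (g z))\<^sup>2"
        by (intro power_mono) auto
      thus ?case by (simp add: power_mult_distrib)
    qed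
  qed (use f assms(1) L2_integrable_sq in auto)
  hence "(L2_norm f)\<^sup>2 \<le> (C * L2_norm g)\<^sup>2"
    by (simp add: L2_norm_sq power_mult_distrib)
  thus ?thesis by (rule power2_le_imp_le) (use assms(3) in simp)
qed

lemma L2_norm_cmult: "f \<in> L2 \<Longrightarrow> L2_norm (\<lambda>z. c * f z) = norm c * L2_norm f"
  by (simp add: L2_norm_def norm_mult power_mult_distrib real_sqrt_mult)

text \<open>
  The discriminant criterion.  It yields the Cauchy--Schwarz inequality below, and with \<open>A = 0\<close> it
  shows that the linear term of a nonnegative variation vanishes.
\<close>

lemma quadratic_nonneg_imp:
  fixes A B C :: real
  assumes "\<And>t. 0 \<le> A - 2 * t * C + t\<^sup>2 * B" "0 \<le> B"
  shows "C\<^sup>2 \<le> A * B"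
proof (cases "B = 0")
  case True
  have "C = 0"
  proof (rule ccontr)
    assume "C \<noteq> 0"
    hence "2 * ((A + 1) / (2 * C)) * C = A + 1" by simp
    thus False using assms(1)[of "(A + 1) / (2 * C)"] True by simp
  qed
  thus ?thesis using True by simp
next
  case False
  hence B: "B > 0" using assms(2) by simp
  have "0 \<le> (A - 2 * (C / B) * C + (C / B)\<^sup>2 * B) * B"
    using assms(1)[of "C / B"] B by simp
  also have "\<dots> = A * B - C\<^sup>2"
    using B by (simp add: field_simps power2_eq_square)
  finally show ?thesis by simp
qed

lemma L2_Cauchy_Schwarz_norm:
  assumes "f \<in> L2" "g \<in> L2"
  shows "(LINT z|\<mu>. norm (f z * g z)) \<le> L2_norm f * L2_norm g"
proof -
  let ?A = "LINT z|\<mu>. (norm (f z))\<^sup>2" and ?B = "LINT z|\<mu>. (norm (g z))\<^sup>2"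
    and ?C = "LINT z|\<mu>. norm (f z * g z)"
  note I = L2_integrable_sq[OF assms(1)] L2_integrable_sq[OF assms(2)]
    integrable_norm[OF L2_mult_integrable[OF assms]]
  have "?C\<^sup>2 \<le> ?A * ?B"
  proof (rule quadratic_nonneg_imp)
    fix t :: real
    have "0 \<le> (LINT z|\<mu>. (norm (f z) - t * norm (g z))\<^sup>2)" by simp
    also have "\<dots> = (LINT z|\<mu>. (norm (f z))\<^sup>2 - (2 * t) * norm (f z * g z) + t\<^sup>2 * (norm (g z))\<^sup>2)"
      by (intro Bochner_Integration.integral_cong)
         (auto simp: power2_diff norm_mult power_mult_distrib)
    also have "\<dots> = ?A - 2 * t * ?C + t\<^sup>2 * ?B"
      using I by (simp del: norm_mult)
    finally show "0 \<le> ?A - 2 * t * ?C + t\<^sup>2 * ?B" .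
  qed simp
  hence "?C\<^sup>2 \<le> (L2_norm f * L2_norm g)\<^sup>2"
    by (simp add: power_mult_distrib L2_norm_sq)
  thus ?thesis by (rule power2_le_imp_le) simp
qed

lemma L2_norm_one: "L2_norm (\<lambda>_. 1) = 1"
  using circle.prob_space by (simp add: L2_norm_def)

lemma L1_norm_le_L2_norm:
  assumes "f \<in> L2"
  shows "(LINT z|\<mu>. norm (f z)) \<le> L2_norm f"
  using L2_Cauchy_Schwarz_norm[OF assms L2_const[of 1]] by (simp add: L2_norm_one)

lemma L2_norm_triangle:
  assumes "f \<in> L2" "g \<in> L2"
  shows "L2_norm (\<lambda>z. f z + g z) \<le> L2_norm f + L2_norm g"
proof -
  note I = L2_integrable_sq[OF assms(1)] L2_integrable_sq[OF assms(2)]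
    integrable_norm[OF L2_mult_integrable[OF assms]]
  have "(L2_norm (\<lambda>z. f z + g z))\<^sup>2 \<le>
      (LINT z|\<mu>. (norm (f z))\<^sup>2 + 2 * norm (f z * g z) + (norm (g z))\<^sup>2)"
    unfolding L2_norm_sq
  proof (rule integral_mono)
    fix z
    have "(norm (f z + g z))\<^sup>2 \<le> (norm (f z) + norm (g z))\<^sup>2"
      by (intro power_mono norm_triangle_ineq) auto
    thus "(norm (f z + g z))\<^sup>2 \<le> (norm (f z))\<^sup>2 + 2 * norm (f z * g z) + (norm (g z))\<^sup>2"
      by (simp add: power2_sum norm_mult)
  qed (use I L2_integrable_sq[OF L2_add[OF assms]] in auto)
  also have "\<dots> = (L2_norm f)\<^sup>2 + 2 * (LINT z|\<mu>. norm (f z * g z)) + (L2_norm g)\<^sup>2"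
    using I by (simp add: L2_norm_sq del: norm_mult)
  also have "\<dots> \<le> (L2_norm f + L2_norm g)\<^sup>2"
    using L2_Cauchy_Schwarz_norm[OF assms] by (simp add: power2_sum del: norm_mult)
  finally show ?thesis by (rule power2_le_imp_le) simp
qed

lemma L2_norm_triangle_sub:
  assumes "f \<in> L2" "g \<in> L2" "h \<in> L2"
  shows "L2_norm (\<lambda>z. f z - h z) \<le> L2_norm (\<lambda>z. f z - g z) + L2_norm (\<lambda>z. g z - h z)"
  using L2_norm_triangle[OF L2_diff[OF assms(1,2)] L2_diff[OF assms(2,3)]] by simp

lemma L2_norm_diff_le:
  assumes "f \<in> L2" "g \<in> L2"
  shows "\<bar>L2_norm f - L2_norm g\<bar> \<le> L2_norm (\<lambda>z. f z - g z)"
  using L2_norm_triangle[OF L2_diff[OF assms] assms(2)]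
    L2_norm_triangle[OF L2_diff[OF assms(2,1)] assms(1)]
    L2_norm_minus_commute[of f g]
  by simp

lemma L2_norm_tendsto:
  assumes "\<And>n. F n \<in> L2" "f \<in> L2" "(\<lambda>n. L2_norm (\<lambda>z. F n z - f z)) \<longlonglongrightarrow> 0"
  shows "(\<lambda>n. L2_norm (F n)) \<longlonglongrightarrow> L2_norm f"
proof -
  have "(\<lambda>n. L2_norm (F n) - L2_norm f) \<longlonglongrightarrow> 0"
    by (rule Lim_null_comparison[OF _ assms(3)]) (use L2_norm_diff_le[OF assms(1,2)] in auto)
  thus ?thesis by (simp add: LIM_zero_iff)
qed

text \<open>
  Fatou's lemma, in the form in which completeness needs it: a pointwise limit inherits both
  membership in \<open>L\<^sup>2\<close> and the norm bound.
\<close>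

lemma L2_Fatou:
  assumes F: "\<And>i. F i \<in> L2" "\<And>i. L2_norm (F i) \<le> e" and e: "0 \<le> e"
    and f: "f \<in> borel_measurable \<mu>" and lim: "AE z in \<mu>. (\<lambda>i::nat. F i z) \<longlonglongrightarrow> f z"
  shows "f \<in> L2" "L2_norm f \<le> e"
proof -
  have [measurable]: "F i \<in> borel_measurable \<mu>" for i using F(1) by (rule L2_measurable)
  have "(\<integral>\<^sup>+z. ennreal ((norm (f z))\<^sup>2) \<partial>\<mu>) =
      (\<integral>\<^sup>+z. liminf (\<lambda>i. ennreal ((norm (F i z))\<^sup>2)) \<partial>\<mu>)"
  proof (rule nn_integral_cong_AE, use lim in eventually_elim)
    case (elim z)
    hence "(\<lambda>i. ennreal ((norm (F i z))\<^sup>2)) \<longlonglongrightarrow> ennreal ((norm (f z))\<^sup>2)"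
      by (intro tendsto_ennrealI tendsto_intros)
    from lim_imp_Liminf[OF sequentially_bot this] show ?case by simp
  qed
  also have "\<dots> \<le> liminf (\<lambda>i. \<integral>\<^sup>+z. ennreal ((norm (F i z))\<^sup>2) \<partial>\<mu>)"
    by (rule nn_integral_liminf) measurable
  also have "\<dots> \<le> ennreal (e\<^sup>2)"
  proof (rule Liminf_le)
    have "(\<integral>\<^sup>+z. ennreal ((norm (F i z))\<^sup>2) \<partial>\<mu>) \<le> ennreal (e\<^sup>2)" for i
    proof -
      have "(\<integral>\<^sup>+z. ennreal ((norm (F i z))\<^sup>2) \<partial>\<mu>) = ennreal ((L2_norm (F i))\<^sup>2)"
        unfolding L2_norm_sq by (rule nn_integral_eq_integral) (use L2_integrable_sq F(1) in auto)
      also have "\<dots> \<le> ennreal (e\<^sup>2)"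
        using F(2)[of i] by (intro ennreal_leI power_mono) auto
      finally show ?thesis .
    qed
    thus "\<forall>\<^sub>F i in sequentially. (\<integral>\<^sup>+z. ennreal ((norm (F i z))\<^sup>2) \<partial>\<mu>) \<le> ennreal (e\<^sup>2)"
      by simp
  qed simp
  finally have le: "(\<integral>\<^sup>+z. ennreal ((norm (f z))\<^sup>2) \<partial>\<mu>) \<le> ennreal (e\<^sup>2)" .
  have int: "integrable \<mu> (\<lambda>z. (norm (f z))\<^sup>2)"
  proof (rule integrableI_nonneg)
    show "(\<integral>\<^sup>+z. ennreal ((norm (f z))\<^sup>2) \<partial>\<mu>) < \<infinity>"
      using le by (simp add: le_less_trans)
  qed (use f in auto)
  thus "f \<in> L2" using f by (simp add: L2_def)
  have "ennreal ((L2_norm f)\<^sup>2) \<le> ennreal (e\<^sup>2)"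
    unfolding L2_norm_sq by (subst nn_integral_eq_integral[symmetric]) (use int le in auto)
  hence "(L2_norm f)\<^sup>2 \<le> e\<^sup>2" by (simp add: ennreal_le_iff)
  thus "L2_norm f \<le> e" using e by (rule power2_le_imp_le)
qed

text \<open>
  Since the measure is finite, an \<open>L\<^sup>2\<close> Cauchy sequence is Cauchy in \<open>L\<^sup>1\<close>, so a subsequence
  converges almost everywhere.  Fatou's lemma, applied to the differences with a fixed member of
  the sequence, turns this into convergence in \<open>L\<^sup>2\<close>.
\<close>

theorem L2_complete:
  assumes F: "\<And>n::nat. F n \<in> L2"
    and Cauchy: "\<And>e. e > 0 \<Longrightarrow> \<exists>N. \<forall>m\<ge>N. \<forall>n\<ge>N. L2_norm (\<lambda>z. F m z - F n z) < e"
  obtains f where "f \<in> L2" "(\<lambda>n. L2_norm (\<lambda>z. F n z - f z)) \<longlonglongrightarrow> 0"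
proof -
  have [measurable]: "F i \<in> borel_measurable \<mu>" for i using F(1) by (rule L2_measurable)
  have "\<exists>N. \<forall>i\<ge>N. \<forall>j\<ge>N. (LINT z|\<mu>. norm (F i z - F j z)) < e" if "e > 0" for e
    using Cauchy[OF that] L1_norm_le_L2_norm[OF L2_diff[OF F F]] by (meson le_less_trans)
  then obtain r where r: "strict_mono r" "AE z in \<mu>. Cauchy (\<lambda>i. F (r i) z)"
    using cauchy_L1_AE_cauchy_subseq[of \<mu> F] L2_integrable[OF F] by blast
  define f where "f z = lim (\<lambda>i. F (r i) z)" for z
  have f [measurable]: "f \<in> borel_measurable \<mu>"
    unfolding f_def by (rule borel_measurable_lim_metric) measurable
  have lim: "AE z in \<mu>. (\<lambda>i. F (r i) z) \<longlonglongrightarrow> f z"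
    using r(2) by eventually_elim (simp add: f_def Cauchy_convergent_iff convergent_LIMSEQ_iff)
  have tail: "\<exists>N. \<forall>n\<ge>N. (\<lambda>z. f z - F n z) \<in> L2 \<and> L2_norm (\<lambda>z. F n z - f z) \<le> e"
    if e: "e > 0" for e
  proof -
    obtain N where N: "\<And>m n. m \<ge> N \<Longrightarrow> n \<ge> N \<Longrightarrow> L2_norm (\<lambda>z. F m z - F n z) < e"
      using Cauchy[OF e] by blast
    have "(\<lambda>z. f z - F n z) \<in> L2 \<and> L2_norm (\<lambda>z. f z - F n z) \<le> e" if n: "n \<ge> N" for n
    proof -
      define G where "G i z = F (r (i + N)) z - F n z" for i z
      have "r (i + N) \<ge> N" for i using seq_suble[OF r(1), of "i + N"] by simp
      hence "L2_norm (G i) \<le> e" for i unfolding G_def using N[OF _ n] by (simp add: less_imp_le)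
      moreover have "G i \<in> L2" for i unfolding G_def by (intro L2_diff F)
      moreover have "AE z in \<mu>. (\<lambda>i. G i z) \<longlonglongrightarrow> f z - F n z"
        using lim
      proof eventually_elim
        case (elim z)
        show ?case unfolding G_def
          by (intro tendsto_intros LIMSEQ_ignore_initial_segment[OF elim])
      qed
      ultimately show ?thesis
        using L2_Fatou[of G e "\<lambda>z. f z - F n z"] e by auto
    qed
    thus ?thesis using L2_norm_minus_commute by metis
  qed
  obtain n where "(\<lambda>z. f z - F n z) \<in> L2" using tail[of 1] by auto
  from L2_add[OF this F[of n]] have "f \<in> L2" by simp
  moreover have "(\<lambda>n. L2_norm (\<lambda>z. F n z - f z)) \<longlonglongrightarrow> 0"
  proof (rule LIMSEQ_I)
    fix e :: real assume "e > 0"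
    thus "\<exists>N. \<forall>n\<ge>N. norm (L2_norm (\<lambda>z. F n z - f z) - 0) < e"
      using tail[of "e / 2"] by fastforce
  qed
  ultimately show ?thesis by (rule that)
qed

section \<open>Fourier coefficients\<close>

lemma measurable_cis_circle [measurable]: "cis \<in> measurable borel \<mu>"
proof -
  have "cis \<in> borel_measurable borel"
    by (intro borel_measurable_continuous_onI continuous_intros)
  hence "cis \<in> measurable borel (restrict_space borel (sphere 0 1))"
    by (intro measurable_restrict_space2) auto
  thus ?thesis using measurable_cong_sets[OF refl sets_circle_measure] by blast
qed

lemma circle_measure_eq_distr:
  "\<mu> = distr (uniform_measure lborel {0..2*pi}) \<mu> cis"
  using distr_cong[OF refl sets_circle_measure refl, of "uniform_measure lborel {0..2*pi}" cis]
  unfolding circle_measure_def by simp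

lemma nn_integral_circle:
  assumes [measurable]: "f \<in> borel_measurable \<mu>"
  shows "(\<integral>\<^sup>+z. f z \<partial>\<mu>) = (\<integral>\<^sup>+t. f (cis t) * indicator {0..2*pi} t \<partial>lborel) / ennreal (2 * pi)"
proof -
  have "(\<integral>\<^sup>+z. f z \<partial>\<mu>) = (\<integral>\<^sup>+z. f z \<partial>distr (uniform_measure lborel {0..2*pi}) \<mu> cis)"
    using circle_measure_eq_distr by simp
  also have "\<dots> = (\<integral>\<^sup>+t. f (cis t) \<partial>uniform_measure lborel {0..2*pi})"
    by (rule nn_integral_distr) auto
  also have "\<dots> = (\<integral>\<^sup>+t. f (cis t) * indicator {0..2*pi} t \<partial>lborel) / emeasure lborel {0..2*pi}"
    by (rule nn_integral_uniform_measure) auto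
  finally show ?thesis by simp
qed

lemma integral_circle:
  fixes f :: "complex \<Rightarrow> complex"
  assumes [measurable]: "f \<in> borel_measurable \<mu>"
  shows "(LINT z|\<mu>. f z) = (LINT t|lborel. indicator {0..2*pi} t *\<^sub>R f (cis t)) / of_real (2 * pi)"
proof -
  have U: "uniform_measure lborel {0..2*pi} =
      density lborel (\<lambda>t. ennreal (indicator {0..2*pi} t / (2 * pi)))"
    unfolding uniform_measure_def
    by (intro density_cong)
       (auto simp: divide_ennreal ennreal_1[symmetric] simp del: ennreal_1 split: split_indicator)
  have "(LINT z|\<mu>. f z) = (LINT z|distr (uniform_measure lborel {0..2*pi}) \<mu> cis. f z)"
    using circle_measure_eq_distr by simp
  also have "\<dots> = (LINT t|uniform_measure lborel {0..2*pi}. f (cis t))"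
    by (rule integral_distr) auto
  also have "\<dots> = (LINT t|lborel. (indicator {0..2*pi} t / (2 * pi)) *\<^sub>R f (cis t))"
    unfolding U by (rule integral_density) (auto split: split_indicator)
  also have "\<dots> = (LINT t|lborel. (indicator {0..2*pi} t *\<^sub>R f (cis t)) / of_real (2 * pi))"
    by (intro Bochner_Integration.integral_cong) (auto simp: scaleR_conv_of_real)
  finally show ?thesis by simp
qed

lemma measurable_powi_circle [measurable]: "(\<lambda>z. z powi n) \<in> borel_measurable \<mu>"
proof (cases "n \<ge> 0")
  case True
  thus ?thesis by (simp add: power_int_def)
next
  case False
  thus ?thesis by (simp add: power_int_def)
qed

lemma norm_powi_circle: "norm (z::complex) = 1 \<Longrightarrow> norm (z powi n) = 1"
  by (simp add: norm_power_int)

lemma cnj_eq_inverse_circle: "norm z = 1 \<Longrightarrow> cnj z = inverse z"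
  by (rule inverse_unique[symmetric]) (simp add: complex_norm_square[symmetric])

lemma cnj_powi_circle: "norm z = 1 \<Longrightarrow> cnj (z powi n) = z powi (- n)"
  by (simp add: cnj_eq_inverse_circle power_int_minus power_int_inverse)

lemma integral_powi_circle: "(LINT z|\<mu>. z powi n) = (if n = 0 then 1 else 0)"
proof (cases "n = 0")
  case True
  thus ?thesis using circle.prob_space by simp
next
  case False
  define F where "F t = exp (\<i> * of_int n * of_real t) / (\<i> * of_int n)" for t :: real
  have "(LINT t|lborel. indicator {0..2*pi} t *\<^sub>R (cis t powi n)) = F (2*pi) - F 0"
  proof (rule integral_FTC_Icc)
    have "((\<lambda>z. exp (\<i> * of_int n * z) / (\<i> * of_int n)) has_field_derivative
        exp (\<i> * of_int n * of_real t)) (at (of_real t))" for t :: real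
      using False by (auto intro!: derivative_eq_intros)
    from has_vector_derivative_real_field[OF this]
    have "(F has_vector_derivative exp (\<i> * of_int n * of_real t)) (at t within {0..2*pi})" for t
      unfolding F_def .
    moreover have "cis t powi n = exp (\<i> * of_int n * of_real t)" for t
      by (subst cis_power_int) (simp add: cis_conv_exp mult_ac)
    ultimately show "(F has_vector_derivative cis t powi n) (at t within {0..2*pi})" for t
      by simp
    show "continuous_on {0..2*pi} (\<lambda>t. cis t powi n)"
      by (intro continuous_intros) auto
  qed auto
  also have "F (2*pi) = F 0"
  proof -
    have "exp (\<i> * of_int n * of_real (2 * pi)) = exp ((2 * of_int n * pi) * \<i>)"
      by (simp add: mult_ac)
    also have "\<dots> = 1" by (rule exp_integer_2pi) auto
    finally show ?thesis by (simp add: F_def)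
  qed
  finally show ?thesis
    using False by (subst integral_circle) auto
qed

text \<open>
  Conjugation is the substitution \<open>t \<mapsto> 2 * pi - t\<close> of the angle.  Its invariance makes \<open>J\<close> an
  isometry of \<open>L\<^sup>2\<close>, by which estimates for \<open>u * Jf\<close> become estimates for \<open>Ju * f\<close>.
\<close>

lemma distr_cnj_circle: "distr \<mu> \<mu> cnj = \<mu>"
proof (rule measure_eqI)
  fix A assume "A \<in> sets (distr \<mu> \<mu> cnj)"
  hence A [measurable]: "A \<in> sets \<mu>" by simp
  have [measurable]: "(indicator A :: complex \<Rightarrow> ennreal) \<in> borel_measurable \<mu>" by simp
  have "emeasure (distr \<mu> \<mu> cnj) A = (\<integral>\<^sup>+z. indicator A z \<partial>distr \<mu> \<mu> cnj)"
    by simp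
  also have "\<dots> = (\<integral>\<^sup>+z. indicator A (cnj z) \<partial>\<mu>)"
    by (rule nn_integral_distr) auto
  also have "\<dots> = (\<integral>\<^sup>+t. indicator A (cnj (cis t)) * indicator {0..2*pi} t \<partial>lborel) / ennreal (2 * pi)"
    by (rule nn_integral_circle) auto
  also have "(\<integral>\<^sup>+t. indicator A (cnj (cis t)) * indicator {0..2*pi} t \<partial>lborel) =
      (\<integral>\<^sup>+t. indicator A (cis t) * indicator {0..2*pi} t \<partial>lborel)"
  proof -
    have [measurable]: "(\<lambda>t. indicator A (cis t) * indicator {0..2*pi} t :: ennreal) \<in> borel_measurable borel"
      by measurable
    have "(\<integral>\<^sup>+t. indicator A (cis t) * indicator {0..2*pi} t \<partial>lborel) =
        (\<integral>\<^sup>+t. indicator A (cis (2*pi + (-1) * t)) * indicator {0..2*pi} (2*pi + (-1) * t) \<partial>lborel)"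
      by (subst nn_integral_real_affine[where c = "-1" and t = "2*pi"]) auto
    also have "\<dots> = (\<integral>\<^sup>+t. indicator A (cnj (cis t)) * indicator {0..2*pi} t \<partial>lborel)"
    proof (intro nn_integral_cong)
      fix t
      have "cis (2*pi + (-1) * t) = cnj (cis t)"
        by (simp add: cis_cnj complex_eq_iff cos_diff sin_diff)
      thus "indicator A (cis (2*pi + (-1) * t)) * indicator {0..2*pi} (2*pi + (-1) * t) =
          (indicator A (cnj (cis t)) * indicator {0..2*pi} t :: ennreal)"
        by (auto split: split_indicator)
    qed
    finally show ?thesis by simp
  qed
  also have "\<dots> / ennreal (2 * pi) = (\<integral>\<^sup>+z. indicator A z \<partial>\<mu>)"
    by (rule nn_integral_circle[symmetric]) auto
  also have "\<dots> = emeasure \<mu> A" by simp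
  finally show "emeasure (distr \<mu> \<mu> cnj) A = emeasure \<mu> A" .
qed simp

lemma measurable_compose_cnj_circle: "f \<in> borel_measurable \<mu> \<Longrightarrow> (\<lambda>z. f (cnj z)) \<in> borel_measurable \<mu>"
  by (rule measurable_compose[OF measurable_circle_cnj])

lemma integral_cnj_circle:
  fixes f :: "complex \<Rightarrow> 'a :: {banach, second_countable_topology}"
  assumes "f \<in> borel_measurable \<mu>"
  shows "(LINT z|\<mu>. f (cnj z)) = (LINT z|\<mu>. f z)"
  using integral_distr[OF measurable_circle_cnj, of f] assms distr_cnj_circle by simp

lemma integrable_cnj_circle:
  fixes f :: "complex \<Rightarrow> 'a :: {banach, second_countable_topology}"
  assumes "integrable \<mu> f"
  shows "integrable \<mu> (\<lambda>z. f (cnj z))"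
  using integrable_distr[OF measurable_circle_cnj, of f] assms distr_cnj_circle by simp

lemma AE_cnj_circle:
  assumes "AE z in \<mu>. P z"
  shows "AE z in \<mu>. P (cnj z)"
proof -
  have "AE z in distr \<mu> \<mu> cnj. P z" unfolding distr_cnj_circle by (rule assms)
  thus ?thesis by (rule AE_distrD[OF measurable_circle_cnj])
qed

lemma refl_J_measurable [measurable (raw)]:
  "f \<in> borel_measurable \<mu> \<Longrightarrow> refl_J f \<in> borel_measurable \<mu>"
  unfolding refl_J_def by (rule measurable_compose_cnj_circle)

lemma L2_refl_J: "f \<in> L2 \<Longrightarrow> refl_J f \<in> L2"
  using integrable_cnj_circle[of "\<lambda>z. (norm (f z))\<^sup>2"]
  by (auto simp: L2_def refl_J_def measurable_compose_cnj_circle)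

lemma L2_norm_refl_J: "f \<in> L2 \<Longrightarrow> L2_norm (refl_J f) = L2_norm f"
  using integral_cnj_circle[of "\<lambda>z. (norm (f z))\<^sup>2"] L2_measurable[of f]
  by (simp add: L2_norm_def refl_J_def)

lemma integrable_mult_bounded:
  fixes b k :: "complex \<Rightarrow> complex"
  assumes "integrable \<mu> k" "b \<in> borel_measurable \<mu>" "AE z in \<mu>. norm (b z) \<le> C"
  shows "integrable \<mu> (\<lambda>z. b z * k z)"
proof (rule Bochner_Integration.integrable_bound)
  show "integrable \<mu> (\<lambda>z. C * norm (k z))" using assms(1) by simp
  show "(\<lambda>z. b z * k z) \<in> borel_measurable \<mu>" using assms(1,2) by measurable
  show "AE z in \<mu>. norm (b z * k z) \<le> norm (C * norm (k z))"
    using assms(3)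
  proof eventually_elim
    case (elim z)
    hence "norm (b z) * norm (k z) \<le> \<bar>C\<bar> * norm (k z)" by (intro mult_right_mono) auto
    thus ?case by (simp add: norm_mult abs_mult)
  qed
qed

lemma integrable_mult_powi:
  assumes "integrable \<mu> k"
  shows "integrable \<mu> (\<lambda>z. k z * z powi n)"
proof -
  have "integrable \<mu> (\<lambda>z. z powi n * k z)"
    by (rule integrable_mult_bounded[OF assms, of _ 1])
       (use AE_norm_circle in \<open>auto simp: norm_powi_circle\<close>)
  thus ?thesis by (simp add: mult.commute)
qed

lemma fourier_coeff_add:
  "integrable \<mu> f \<Longrightarrow> integrable \<mu> g \<Longrightarrow>
    fourier_coeff (\<lambda>z. f z + g z) n = fourier_coeff f n + fourier_coeff g n"
  by (simp add: fourier_coeff_def distrib_right integrable_mult_powi del: power_int_minus)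

lemma fourier_coeff_diff:
  "integrable \<mu> f \<Longrightarrow> integrable \<mu> g \<Longrightarrow>
    fourier_coeff (\<lambda>z. f z - g z) n = fourier_coeff f n - fourier_coeff g n"
  by (simp add: fourier_coeff_def left_diff_distrib integrable_mult_powi del: power_int_minus)

lemma fourier_coeff_cmult: "fourier_coeff (\<lambda>z. c * f z) n = c * fourier_coeff f n"
  by (simp add: fourier_coeff_def mult.assoc)

lemma fourier_coeff_sum:
  assumes "\<And>i. i \<in> A \<Longrightarrow> integrable \<mu> (f i)"
  shows "fourier_coeff (\<lambda>z. \<Sum>i\<in>A. f i z) n = (\<Sum>i\<in>A. fourier_coeff (f i) n)"
  unfolding fourier_coeff_def sum_distrib_right
  by (rule Bochner_Integration.integral_sum) (use assms integrable_mult_powi in auto)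

lemma fourier_coeff_powi: "fourier_coeff (\<lambda>z. z powi m) n = (if m = n then 1 else 0)"
proof -
  have "fourier_coeff (\<lambda>z. z powi m) n = (LINT z|\<mu>. z powi (m - n))"
    unfolding fourier_coeff_def
  proof (rule Bochner_Integration.integral_cong)
    fix z :: complex assume "z \<in> space \<mu>"
    hence "z \<noteq> 0" by auto
    thus "z powi m * z powi (- n) = z powi (m - n)"
      using power_int_add[of z m "- n"] by simp
  qed simp
  thus ?thesis by (simp add: integral_powi_circle)
qed

lemma fourier_coeff_mult_powi:
  "fourier_coeff (\<lambda>z. f z * z powi m) n = fourier_coeff f (n - m)"
  unfolding fourier_coeff_def
proof (rule Bochner_Integration.integral_cong)
  fix z :: complex assume "z \<in> space \<mu>"
  hence "z \<noteq> 0" by auto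
  thus "f z * z powi m * z powi (- n) = f z * z powi (- (n - m))"
    using power_int_add[of z m "- n"] by simp
qed simp

lemma norm_fourier_coeff_le:
  "norm (fourier_coeff f n) \<le> (LINT z|\<mu>. norm (f z))"
proof -
  have "norm (fourier_coeff f n) \<le> (LINT z|\<mu>. norm (f z * z powi (- n)))"
    unfolding fourier_coeff_def by (rule integral_norm_bound)
  also have "\<dots> = (LINT z|\<mu>. norm (f z))"
  proof (rule Bochner_Integration.integral_cong)
    fix z :: complex assume "z \<in> space \<mu>"
    hence "norm z = 1" by auto
    thus "norm (f z * z powi (- n)) = norm (f z)"
      unfolding norm_mult using norm_powi_circle[of z "- n"] by simp
  qed simp
  finally show ?thesis .
qed

lemma fourier_coeff_tendsto_L1:
  assumes "\<And>j. integrable \<mu> (F j)" "integrable \<mu> f" "(\<lambda>j. LINT z|\<mu>. norm (F j z - f z)) \<longlonglongrightarrow> 0"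
  shows "(\<lambda>j::nat. fourier_coeff (F j) n) \<longlonglongrightarrow> fourier_coeff f n"
proof -
  have "(\<lambda>j. fourier_coeff (F j) n - fourier_coeff f n) \<longlonglongrightarrow> 0"
  proof (rule Lim_null_comparison[OF _ assms(3)])
    show "\<forall>\<^sub>F j in sequentially. norm (fourier_coeff (F j) n - fourier_coeff f n)
        \<le> (LINT z|\<mu>. norm (F j z - f z))"
      using norm_fourier_coeff_le[of "\<lambda>z. F _ z - f z" n] assms(1,2)
      by (simp add: fourier_coeff_diff)
  qed
  thus ?thesis by (simp add: LIM_zero_iff)
qed

lemma L1_tendsto_mult_L2:
  assumes "\<And>j. F j \<in> L2" "f \<in> L2" "g \<in> L2" "(\<lambda>j. L2_norm (\<lambda>z. F j z - f z)) \<longlonglongrightarrow> 0"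
  shows "(\<lambda>j. LINT z|\<mu>. norm (F j z * g z - f z * g z)) \<longlonglongrightarrow> 0"
proof (rule Lim_null_comparison)
  show "\<forall>\<^sub>F j in sequentially. norm (LINT z|\<mu>. norm (F j z * g z - f z * g z))
      \<le> L2_norm (\<lambda>z. F j z - f z) * L2_norm g"
    using L2_Cauchy_Schwarz_norm[OF L2_diff[OF assms(1,2)] assms(3)]
    by (simp add: left_diff_distrib)
  show "(\<lambda>j. L2_norm (\<lambda>z. F j z - f z) * L2_norm g) \<longlonglongrightarrow> 0"
    using tendsto_mult_right[OF assms(4), of "L2_norm g"] by simp
qed

text \<open>
  A product with one factor converging in \<open>L\<^sup>2\<close> and the other fixed in \<open>L\<^sup>2\<close> converges in \<open>L\<^sup>1\<close>.  All
  limits of coefficients of the merely integrable functions \<open>u * Jf\<close> are taken in this way.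
\<close>

lemma fourier_coeff_tendsto_mult_L2:
  assumes "\<And>j. F j \<in> L2" "f \<in> L2" "g \<in> L2" "(\<lambda>j. L2_norm (\<lambda>z. F j z - f z)) \<longlonglongrightarrow> 0"
  shows "(\<lambda>j. fourier_coeff (\<lambda>z. F j z * g z) n) \<longlonglongrightarrow> fourier_coeff (\<lambda>z. f z * g z) n"
  by (rule fourier_coeff_tendsto_L1) (use assms L2_mult_integrable L1_tendsto_mult_L2 in auto)

lemma fourier_coeff_tendsto_L2:
  assumes "\<And>j. F j \<in> L2" "f \<in> L2" "(\<lambda>j. L2_norm (\<lambda>z. F j z - f z)) \<longlonglongrightarrow> 0"
  shows "(\<lambda>j. fourier_coeff (F j) n) \<longlonglongrightarrow> fourier_coeff f n"
  using fourier_coeff_tendsto_mult_L2[OF assms(1,2) L2_const[of 1] assms(3)] by simp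

section \<open>Uniqueness of Fourier coefficients\<close>

text \<open>
  To prove that an integrable function with vanishing Fourier coefficients is zero, consider the
  bounded functions \<open>b\<close> whose product with every such function again has vanishing coefficients.
  They visibly form an algebra that contains \<open>z\<close> and its inverse, and it is closed under bounded
  pointwise limits.  So it contains the real polynomials in the coordinates, then by the
  Weierstrass approximation theorem all continuous functions, then the indicators of closed sets,
  and finally the indicators of all Borel sets.
\<close>

definition fourier_null :: "(complex \<Rightarrow> complex) \<Rightarrow> bool" where
  "fourier_null k \<longleftrightarrow> integrable \<mu> k \<and> (\<forall>n. fourier_coeff k n = 0)"

definition null_multiplier :: "(complex \<Rightarrow> complex) \<Rightarrow> bool" where
  "null_multiplier b \<longleftrightarrow> b \<in> borel_measurable \<mu> \<and> (\<exists>C. \<forall>z. norm z = 1 \<longrightarrow> norm (b z) \<le> C) \<and>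
     (\<forall>k. fourier_null k \<longrightarrow> fourier_null (\<lambda>z. b z * k z))"

lemma null_multiplierI:
  assumes "b \<in> borel_measurable \<mu>" "\<And>z. norm z = 1 \<Longrightarrow> norm (b z) \<le> C"
    and "\<And>k n. fourier_null k \<Longrightarrow> fourier_coeff (\<lambda>z. b z * k z) n = 0"
  shows "null_multiplier b"
proof -
  have "integrable \<mu> (\<lambda>z. b z * k z)" if "fourier_null k" for k
    by (rule integrable_mult_bounded[OF _ assms(1), of _ C])
       (use that assms(2) in \<open>auto simp: fourier_null_def intro!: AE_I2\<close>)
  thus ?thesis using assms unfolding null_multiplier_def fourier_null_def
    by (auto intro!: exI[of _ C])
qed

lemma null_multiplierD:
  assumes "null_multiplier b"
  shows "b \<in> borel_measurable \<mu>" "\<exists>C. \<forall>z. norm z = 1 \<longrightarrow> norm (b z) \<le> C"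
    "fourier_null k \<Longrightarrow> fourier_null (\<lambda>z. b z * k z)"
  using assms by (simp_all add: null_multiplier_def)

lemma null_multiplier_const: "null_multiplier (\<lambda>z. c)"
  by (rule null_multiplierI[of _ "norm c"]) (auto simp: fourier_coeff_cmult fourier_null_def)

lemma null_multiplier_powi: "null_multiplier (\<lambda>z. z powi m)"
proof (rule null_multiplierI[of _ 1])
  show "fourier_coeff (\<lambda>z. z powi m * k z) n = 0" if "fourier_null k" for k n
    using that fourier_coeff_mult_powi[of k m n] by (simp add: fourier_null_def mult.commute)
qed (auto simp: norm_powi_circle)

lemma null_multiplier_cong:
  assumes "null_multiplier b" "\<And>z. norm z = 1 \<Longrightarrow> b z = b' z"
  shows "null_multiplier b'"
proof (rule null_multiplierI)
  show "b' \<in> borel_measurable \<mu>"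
    using null_multiplierD(1)[OF assms(1)] assms(2) measurable_cong[of \<mu> b b' borel] by simp
  define C where "C = (SOME C. \<forall>z. norm z = 1 \<longrightarrow> norm (b z) \<le> C)"
  have "\<forall>z. norm z = 1 \<longrightarrow> norm (b z) \<le> C"
    unfolding C_def using null_multiplierD(2)[OF assms(1)] by (rule someI_ex)
  thus "norm (b' z) \<le> C" if "norm z = 1" for z
    using that assms(2)[OF that] by metis
  fix k n assume "fourier_null k"
  hence "fourier_coeff (\<lambda>z. b z * k z) n = 0"
    using null_multiplierD(3)[OF assms(1)] by (simp add: fourier_null_def)
  moreover have "fourier_coeff (\<lambda>z. b z * k z) n = fourier_coeff (\<lambda>z. b' z * k z) n"
    unfolding fourier_coeff_def using assms(2) by (intro Bochner_Integration.integral_cong) auto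
  ultimately show "fourier_coeff (\<lambda>z. b' z * k z) n = 0" by simp
qed

lemma null_multiplier_add:
  assumes "null_multiplier b" "null_multiplier c"
  shows "null_multiplier (\<lambda>z. b z + c z)"
proof -
  obtain B C where BC: "\<And>z. norm z = 1 \<Longrightarrow> norm (b z) \<le> B" "\<And>z. norm z = 1 \<Longrightarrow> norm (c z) \<le> C"
    using assms[THEN null_multiplierD(2)] by blast
  show ?thesis
  proof (rule null_multiplierI)
    show "(\<lambda>z. b z + c z) \<in> borel_measurable \<mu>"
      using assms[THEN null_multiplierD(1)] by measurable
    show "norm (b z + c z) \<le> B + C" if "norm z = 1" for z
      using BC[OF that] by norm
    fix k n assume k: "fourier_null k"
    show "fourier_coeff (\<lambda>z. (b z + c z) * k z) n = 0"
      using null_multiplierD(3)[OF assms(1) k] null_multiplierD(3)[OF assms(2) k]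
      by (simp add: fourier_null_def distrib_right fourier_coeff_add)
  qed
qed

lemma null_multiplier_mult:
  assumes "null_multiplier b" "null_multiplier c"
  shows "null_multiplier (\<lambda>z. b z * c z)"
proof -
  obtain B C where BC: "\<And>z. norm z = 1 \<Longrightarrow> norm (b z) \<le> B" "\<And>z. norm z = 1 \<Longrightarrow> norm (c z) \<le> C"
    using assms[THEN null_multiplierD(2)] by blast
  show ?thesis
  proof (rule null_multiplierI)
    show "(\<lambda>z. b z * c z) \<in> borel_measurable \<mu>"
      using assms[THEN null_multiplierD(1)] by measurable
    show "norm (b z * c z) \<le> B * C" if "norm z = 1" for z
      using BC[OF that] unfolding norm_mult
      by (intro mult_mono) (auto intro: order_trans[OF norm_ge_zero])
    fix k n assume k: "fourier_null k"
    show "fourier_coeff (\<lambda>z. b z * c z * k z) n = 0"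
      using null_multiplierD(3)[OF assms(1) null_multiplierD(3)[OF assms(2) k]]
      by (simp add: fourier_null_def mult.assoc)
  qed
qed

lemma null_multiplier_cmult: "null_multiplier b \<Longrightarrow> null_multiplier (\<lambda>z. c * b z)"
  by (rule null_multiplier_mult[OF null_multiplier_const])

lemma null_multiplier_bounded_limit:
  assumes "\<And>i::nat. null_multiplier (b i)" "\<And>i z. norm z = 1 \<Longrightarrow> norm (b i z) \<le> C"
    and lim: "\<And>z. norm z = 1 \<Longrightarrow> (\<lambda>i. b i z) \<longlonglongrightarrow> c z"
  shows "null_multiplier c"
proof (rule null_multiplierI)
  have [measurable]: "b i \<in> borel_measurable \<mu>" for i
    using assms(1) by (rule null_multiplierD)
  show c [measurable]: "c \<in> borel_measurable \<mu>"
    by (rule borel_measurable_LIMSEQ_metric[of b]) (use lim in auto)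
  show "norm (c z) \<le> C" if "norm z = 1" for z
    by (rule LIMSEQ_le_const2[OF tendsto_norm[OF lim[OF that]]]) (use assms(2) that in auto)
  fix k n assume k: "fourier_null k"
  hence int: "integrable \<mu> k" by (simp add: fourier_null_def)
  hence [measurable]: "k \<in> borel_measurable \<mu>" by simp
  have "(\<lambda>i. fourier_coeff (\<lambda>z. b i z * k z) n) \<longlonglongrightarrow> fourier_coeff (\<lambda>z. c z * k z) n"
    unfolding fourier_coeff_def
  proof (rule integral_dominated_convergence)
    show "integrable \<mu> (\<lambda>z. C * norm (k z))" using int by simp
    show "AE z in \<mu>. (\<lambda>i. b i z * k z * z powi (- n)) \<longlonglongrightarrow> c z * k z * z powi (- n)"
      by (rule AE_I2) (intro tendsto_intros lim, auto)
    show "AE z in \<mu>. norm (b i z * k z * z powi (- n)) \<le> C * norm (k z)" for i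
    proof (rule AE_I2)
      fix z assume "z \<in> space \<mu>"
      hence z: "norm z = 1" by simp
      show "norm (b i z * k z * z powi (- n)) \<le> C * norm (k z)"
        unfolding norm_mult norm_powi_circle[OF z] using assms(2)[OF z, of i]
        by (simp add: mult_right_mono)
    qed
  qed measurable
  moreover have "fourier_coeff (\<lambda>z. b i z * k z) n = 0" for i
    using null_multiplierD(3)[OF assms(1) k] by (simp add: fourier_null_def)
  ultimately show "fourier_coeff (\<lambda>z. c z * k z) n = 0"
    by (simp add: LIMSEQ_const_iff)
qed

lemma null_multiplier_real_polynomial:
  assumes "real_polynomial_function p"
  shows "null_multiplier (\<lambda>z. complex_of_real (p z))"
  using assms
proof induction
  case (linear f)
  have Re: "null_multiplier (\<lambda>z. complex_of_real (Re z))"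
  proof (rule null_multiplier_cong)
    show "null_multiplier (\<lambda>z. (1/2) * (z powi 1 + z powi (-1)))"
      by (intro null_multiplier_cmult null_multiplier_add null_multiplier_powi)
    show "(1/2) * (z powi 1 + z powi (-1)) = complex_of_real (Re z)" if "norm z = 1" for z
      using cnj_powi_circle[OF that, of 1] complex_add_cnj[of z] by simp
  qed
  have Im: "null_multiplier (\<lambda>z. complex_of_real (Im z))"
  proof (rule null_multiplier_cong)
    show "null_multiplier (\<lambda>z. (1/(2*\<i>)) * (z powi 1 + (-1) * z powi (-1)))"
      by (intro null_multiplier_cmult null_multiplier_add null_multiplier_powi)
    show "(1/(2*\<i>)) * (z powi 1 + (-1) * z powi (-1)) = complex_of_real (Im z)"
      if "norm z = 1" for z
    proof -
      have "z powi 1 + (-1) * z powi (-1) = 2 * \<i> * complex_of_real (Im z)"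
        using cnj_powi_circle[OF that, of 1] complex_diff_cnj[of z] by simp
      thus ?thesis by simp
    qed
  qed
  have "f z = f 1 * Re z + f \<i> * Im z" for z
  proof -
    have "f z = f (Re z *\<^sub>R 1 + Im z *\<^sub>R \<i>)"
      by (rule arg_cong[of _ _ f]) (simp add: complex_eq_iff)
    also have "\<dots> = Re z *\<^sub>R f 1 + Im z *\<^sub>R f \<i>"
      using linear by (simp add: bounded_linear.linear linear_add linear_scale)
    finally show ?thesis by (simp add: mult.commute)
  qed
  hence eq: "complex_of_real (f z) = of_real (f 1) * of_real (Re z) + of_real (f \<i>) * of_real (Im z)" for z
    by (metis of_real_add of_real_mult)
  show ?case
    by (rule null_multiplier_cong[OF null_multiplier_add[OF null_multiplier_cmult[OF Re]
          null_multiplier_cmult[OF Im]] eq[symmetric]])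
qed (auto intro: null_multiplier_const null_multiplier_add null_multiplier_mult)

lemma null_multiplier_continuous:
  fixes h :: "complex \<Rightarrow> real"
  assumes "continuous_on (sphere 0 1) h"
  shows "null_multiplier (\<lambda>z. complex_of_real (h z))"
proof -
  have "\<exists>p. real_polynomial_function p \<and> (\<forall>z\<in>sphere 0 1. \<bar>h z - p z\<bar> < inverse (real (Suc i)))" for i
    using Stone_Weierstrass_real_polynomial_function[OF compact_sphere assms, of "inverse (real (Suc i))"]
    by (metis inverse_positive_iff_positive of_nat_0_less_iff zero_less_Suc)
  then obtain p where p: "\<And>i. real_polynomial_function (p i)"
    "\<And>i z. z \<in> sphere 0 1 \<Longrightarrow> \<bar>h z - p i z\<bar> < inverse (real (Suc i))"
    by metis
  have "compact (h ` sphere 0 1)" by (intro compact_continuous_image assms compact_sphere)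
  then obtain B where B: "\<And>z. z \<in> sphere 0 1 \<Longrightarrow> \<bar>h z\<bar> \<le> B"
    using compact_imp_bounded bounded_iff by (metis imageI real_norm_def)
  show ?thesis
  proof (rule null_multiplier_bounded_limit)
    show "null_multiplier (\<lambda>z. complex_of_real (p i z))" for i
      by (rule null_multiplier_real_polynomial[OF p(1)])
    fix z :: complex assume "norm z = 1"
    hence z: "z \<in> sphere 0 1" by simp
    show "norm (complex_of_real (p i z)) \<le> B + 1" for i
    proof -
      have "inverse (real (Suc i)) \<le> 1" by (simp add: field_simps)
      thus ?thesis using p(2)[OF z, of i] B[OF z] by simp
    qed
    have "(\<lambda>i. p i z - h z) \<longlonglongrightarrow> 0"
    proof (rule Lim_null_comparison[OF _ LIMSEQ_inverse_real_of_nat])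
      show "\<forall>\<^sub>F i in sequentially. norm (p i z - h z) \<le> inverse (real (Suc i))"
        using p(2)[OF z] by (auto simp: abs_minus_commute less_imp_le)
    qed
    hence "(\<lambda>i. p i z) \<longlonglongrightarrow> h z" by (simp add: LIM_zero_iff)
    thus "(\<lambda>i. complex_of_real (p i z)) \<longlonglongrightarrow> complex_of_real (h z)"
      by (rule tendsto_of_real)
  qed
qed

lemma null_multiplier_closed:
  assumes "closed C"
  shows "null_multiplier (indicator C)"
proof (cases "C = {}")
  case True
  thus ?thesis using null_multiplier_const[of 0] by (simp add: indicator_def[abs_def])
next
  case False
  show ?thesis
  proof (rule null_multiplier_bounded_limit)
    show "null_multiplier (\<lambda>z. complex_of_real (max 0 (1 - real i * infdist z C)))" for i
      by (intro null_multiplier_continuous continuous_intros)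
    fix z :: complex
    show "norm (complex_of_real (max 0 (1 - real i * infdist z C))) \<le> 1" for i
      using infdist_nonneg[of z C] by auto
    show "(\<lambda>i. complex_of_real (max 0 (1 - real i * infdist z C))) \<longlonglongrightarrow> indicator C z"
    proof (cases "z \<in> C")
      case True
      thus ?thesis by simp
    next
      case z: False
      hence d: "infdist z C > 0"
        using assms False in_closed_iff_infdist_zero[of C z] infdist_nonneg[of z C] by linarith
      obtain N where N: "1 < real N * infdist z C" using reals_Archimedean3[OF d] by blast
      have "\<forall>\<^sub>F i in sequentially. complex_of_real (max 0 (1 - real i * infdist z C)) = indicator C z"
        using eventually_ge_at_top[of N]
      proof eventually_elim
        case (elim i)
        hence "real N * infdist z C \<le> real i * infdist z C" using d by simp
        thus ?case using N z by simp
      qed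
      thus ?thesis by (rule tendsto_eventually)
    qed
  qed
qed

lemma null_multiplier_Un:
  assumes "null_multiplier (indicator A)" "null_multiplier (indicator B)"
  shows "null_multiplier (indicator (A \<union> B))"
proof (rule null_multiplier_cong)
  show "null_multiplier (\<lambda>z. indicator A z + (indicator B z + (-1) * (indicator A z * indicator B z)))"
    by (intro null_multiplier_add null_multiplier_cmult null_multiplier_mult assms)
qed (auto split: split_indicator)

lemma null_multiplier_borel:
  assumes "A \<in> sets borel"
  shows "null_multiplier (indicator A)"
proof -
  have "A \<in> sigma_sets UNIV (Collect closed)"
    using assms by (simp add: borel_eq_closed)
  thus ?thesis
  proof induction
    case (Basic C)
    thus ?case by (simp add: null_multiplier_closed)
  next
    case Empty
    show ?case by (rule null_multiplier_cong[OF null_multiplier_const[of 0]]) simp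
  next
    case (Compl A)
    show ?case
      by (rule null_multiplier_cong[OF null_multiplier_add[OF null_multiplier_const[of 1]
            null_multiplier_cmult[OF Compl.IH, of "-1"]]]) (auto split: split_indicator)
  next
    case (Union A)
    have fin: "null_multiplier (indicator (\<Union>j<i. A j))" for i :: nat
    proof (induction i)
      case 0
      show ?case by (rule null_multiplier_cong[OF null_multiplier_const[of 0]]) simp
    next
      case (Suc i)
      thus ?case using null_multiplier_Un[OF Union.IH[of i] Suc] by (simp add: lessThan_Suc)
    qed
    show ?case
    proof (rule null_multiplier_bounded_limit[OF fin])
      fix z
      show "norm (indicator (\<Union>j<i. A j) z :: complex) \<le> 1" for i
        by (auto split: split_indicator)
      have "(\<Union>i. \<Union>j<i. A j) = (\<Union>i. A i)" by auto
      thus "(\<lambda>i. indicator (\<Union>j<i. A j) z :: complex) \<longlonglongrightarrow> indicator (\<Union>i. A i) z"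
        using LIMSEQ_indicator_incseq[of "\<lambda>i. \<Union>j<i. A j" z]
        by (auto simp: incseq_def intro: less_le_trans)
    qed
  qed
qed

lemma AE_nonpos_of_set_integrals:
  fixes r :: "'a \<Rightarrow> real"
  assumes "integrable M r" "\<And>A. A \<in> sets M \<Longrightarrow> (LINT x|M. indicator A x * r x) = 0"
  shows "AE x in M. r x \<le> 0"
proof -
  have [measurable]: "r \<in> borel_measurable M" using assms(1) by simp
  let ?A = "{x \<in> space M. r x > 0}"
  have A: "?A \<in> sets M" by measurable
  have "(LINT x|M. indicator ?A x * r x) = 0" by (rule assms(2)[OF A])
  hence "AE x in M. indicator ?A x * r x = 0"
    using integrable_real_mult_indicator[OF A assms(1)]
    by (subst (asm) integral_nonneg_eq_0_iff_AE)
       (auto simp: mult.commute intro!: AE_I2 split: split_indicator)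
  thus ?thesis using AE_space by eventually_elim (auto split: split_indicator_asm)
qed

lemma AE_zero_of_set_integrals:
  fixes r :: "'a \<Rightarrow> real"
  assumes "integrable M r" "\<And>A. A \<in> sets M \<Longrightarrow> (LINT x|M. indicator A x * r x) = 0"
  shows "AE x in M. r x = 0"
proof -
  have "AE x in M. - r x \<le> 0"
    by (rule AE_nonpos_of_set_integrals) (use assms in auto)
  moreover have "AE x in M. r x \<le> 0"
    by (rule AE_nonpos_of_set_integrals) (use assms in auto)
  ultimately show ?thesis by eventually_elim auto
qed

text \<open>
  Multiplication by indicators and the coefficient of index 0 show that the integral of \<open>k\<close> over
  every Borel set is zero.
\<close>

theorem fourier_null_AE_zero:
  assumes "fourier_null k"
  shows "AE z in \<mu>. k z = 0"
proof -
  have int: "integrable \<mu> k" using assms by (simp add: fourier_null_def)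
  have zero: "(LINT z|\<mu>. indicator A z * k z) = 0" if A: "A \<in> sets \<mu>" for A
  proof -
    have "A \<in> sets borel"
      using A by (auto simp: sets_circle_measure sets_restrict_space)
    hence "fourier_null (\<lambda>z. indicator A z * k z)"
      using null_multiplierD(3)[OF null_multiplier_borel assms] by blast
    hence "fourier_coeff (\<lambda>z. indicator A z * k z) 0 = 0"
      by (simp add: fourier_null_def)
    thus ?thesis by (simp add: fourier_coeff_def)
  qed
  have intA: "integrable \<mu> (\<lambda>z. indicator A z * k z)" if "A \<in> sets \<mu>" for A
    by (rule integrable_mult_bounded[OF int, of _ 1]) (use that in \<open>auto split: split_indicator\<close>)
  have ReIm: "Re (indicator A z * k z) = indicator A z * Re (k z)"
    "Im (indicator A z * k z) = indicator A z * Im (k z)" for A z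
    by (auto split: split_indicator)
  have "AE z in \<mu>. Re (k z) = 0"
  proof (rule AE_zero_of_set_integrals)
    show "(LINT z|\<mu>. indicator A z * Re (k z)) = 0" if "A \<in> sets \<mu>" for A
      using zero[OF that] integral_Re[OF intA[OF that]] unfolding ReIm by simp
  qed (use int in auto)
  moreover have "AE z in \<mu>. Im (k z) = 0"
  proof (rule AE_zero_of_set_integrals)
    show "(LINT z|\<mu>. indicator A z * Im (k z)) = 0" if "A \<in> sets \<mu>" for A
      using zero[OF that] integral_Im[OF intA[OF that]] unfolding ReIm by simp
  qed (use int in auto)
  ultimately show ?thesis by eventually_elim (simp add: complex_eq_iff)
qed

lemma AE_eq_of_fourier_coeff_eq:
  assumes "integrable \<mu> f" "integrable \<mu> g" "\<And>n. fourier_coeff f n = fourier_coeff g n"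
  shows "AE z in \<mu>. f z = g z"
  using fourier_null_AE_zero[of "\<lambda>z. f z - g z"] assms
  by (simp add: fourier_null_def fourier_coeff_diff)

section \<open>The Hardy space\<close>

lemma fourier_coeff_power: "fourier_coeff (\<lambda>z. z ^ m) n = (if int m = n then 1 else 0)"
  using fourier_coeff_powi[of "int m" n] by simp

lemma L2_power: "(\<lambda>z. z ^ m) \<in> L2"
  by (rule L2_bounded[of _ 1]) (auto simp: norm_power intro!: AE_I2)

lemma L2_poly: "poly p \<in> L2"
  unfolding poly_altdef[abs_def] by (intro L2_sum L2_cmult L2_power)

lemma L2_partial_sum: "(\<lambda>z. \<Sum>n<N. c n * z ^ n) \<in> L2"
  by (intro L2_sum L2_cmult L2_power)

lemma fourier_coeff_partial_sum:
  "fourier_coeff (\<lambda>z. \<Sum>n<N. c n * z ^ n) m = (if 0 \<le> m \<and> m < int N then c (nat m) else 0)"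
proof -
  have "fourier_coeff (\<lambda>z. \<Sum>n<N. c n * z ^ n) m = (\<Sum>n<N. c n * (if int n = m then 1 else 0))"
    by (subst fourier_coeff_sum)
       (auto simp: fourier_coeff_cmult fourier_coeff_power intro!: L2_integrable[OF L2_cmult[OF L2_power]])
  also have "\<dots> = (\<Sum>n<N. if n = nat m then (if 0 \<le> m then c n else 0) else 0)"
    by (intro sum.cong) auto
  also have "\<dots> = (if 0 \<le> m \<and> m < int N then c (nat m) else 0)"
    by (auto simp: nat_less_iff)
  finally show ?thesis .
qed

lemma norm_diff_square: "(norm (a - b))\<^sup>2 = (norm a)\<^sup>2 + (norm b)\<^sup>2 - 2 * Re (a * cnj b)"
  unfolding cmod_power2 by (simp add: power2_eq_square algebra_simps)

text \<open>
  Removing one Fourier term lowers the squared norm by exactly the squared modulus of the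
  coefficient; Bessel's inequality and Parseval's identity follow by iteration.
\<close>

lemma L2_norm_sq_diff_coeff:
  assumes "f \<in> L2"
  shows "(L2_norm (\<lambda>z. f z - fourier_coeff f (int n) * z ^ n))\<^sup>2 =
    (L2_norm f)\<^sup>2 - (norm (fourier_coeff f (int n)))\<^sup>2"
proof -
  let ?c = "fourier_coeff f (int n)"
  have c: "(LINT z|\<mu>. f z * z powi (- int n)) = ?c" by (simp add: fourier_coeff_def)
  have int: "integrable \<mu> (\<lambda>z. f z * z powi (- int n))"
    by (rule integrable_mult_powi[OF L2_integrable[OF assms]])
  have "(norm (f z - ?c * z ^ n))\<^sup>2 =
      (norm (f z))\<^sup>2 - 2 * Re (cnj ?c * (f z * z powi (- int n))) + (norm ?c)\<^sup>2"
    if z: "norm z = 1" for z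
  proof -
    have "(norm (f z - ?c * z ^ n))\<^sup>2 =
        (norm (f z))\<^sup>2 + (norm (?c * z ^ n))\<^sup>2 - 2 * Re (f z * cnj (?c * z ^ n))"
      by (rule norm_diff_square)
    also have "cnj (?c * z ^ n) = cnj ?c * z powi (- int n)"
      using cnj_powi_circle[OF z, of "int n"] by simp
    also have "norm (?c * z ^ n) = norm ?c" using z by (simp add: norm_mult norm_power)
    finally show ?thesis by (simp add: mult_ac)
  qed
  hence "(L2_norm (\<lambda>z. f z - ?c * z ^ n))\<^sup>2 =
      (LINT z|\<mu>. (norm (f z))\<^sup>2 - 2 * Re (cnj ?c * (f z * z powi (- int n))) + (norm ?c)\<^sup>2)"
    unfolding L2_norm_sq by (intro Bochner_Integration.integral_cong) auto
  also have "\<dots> = (L2_norm f)\<^sup>2 - 2 * (LINT z|\<mu>. Re (cnj ?c * (f z * z powi (- int n)))) + (norm ?c)\<^sup>2"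
  proof -
    have "integrable \<mu> (\<lambda>z. Re (cnj ?c * (f z * z powi (- int n))))"
      by (intro integrable_Re integrable_mult_right int)
    thus ?thesis using L2_integrable_sq[OF assms] circle.prob_space
      by (simp add: L2_norm_sq del: Re_complex_of_real times_complex.sel complex_mult_cnj)
  qed
  also have "(LINT z|\<mu>. Re (cnj ?c * (f z * z powi (- int n)))) = Re (cnj ?c * ?c)"
    by (subst integral_Re) (use int c in simp_all)
  also have "\<dots> = (norm ?c)\<^sup>2"
    unfolding cmod_power2 by (simp add: power2_eq_square)
  finally show ?thesis by simp
qed

lemma L2_norm_sq_diff_partial_sum:
  assumes "f \<in> L2"
  shows "(L2_norm (\<lambda>z. f z - (\<Sum>n<N. fourier_coeff f (int n) * z ^ n)))\<^sup>2 =
    (L2_norm f)\<^sup>2 - (\<Sum>n<N. (norm (fourier_coeff f (int n)))\<^sup>2)"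
proof (induction N)
  case 0
  show ?case by simp
next
  case (Suc N)
  let ?r = "\<lambda>z. f z - (\<Sum>n<N. fourier_coeff f (int n) * z ^ n)"
  have r: "?r \<in> L2" by (intro L2_diff assms L2_partial_sum)
  have "fourier_coeff ?r (int N) = fourier_coeff f (int N)"
    by (simp add: fourier_coeff_diff L2_integrable assms L2_partial_sum fourier_coeff_partial_sum)
  with L2_norm_sq_diff_coeff[OF r, of N] Suc.IH show ?case
    by (simp add: diff_diff_eq)
qed

lemma Bessel_le:
  "f \<in> L2 \<Longrightarrow> (\<Sum>n<N. (norm (fourier_coeff f (int n)))\<^sup>2) \<le> (L2_norm f)\<^sup>2"
  using L2_norm_sq_diff_partial_sum[of f N]
    zero_le_power2[of "L2_norm (\<lambda>z. f z - (\<Sum>n<N. fourier_coeff f (int n) * z ^ n))"]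
  by linarith

lemma Bessel_summable:
  assumes "f \<in> L2"
  shows "summable (\<lambda>n. (norm (fourier_coeff f (int n)))\<^sup>2)"
  by (rule summableI_nonneg_bounded[of _ "(L2_norm f)\<^sup>2"]) (use Bessel_le[OF assms] in auto)

lemma Bessel_suminf:
  assumes "f \<in> L2"
  shows "(\<Sum>n. (norm (fourier_coeff f (int n)))\<^sup>2) \<le> (L2_norm f)\<^sup>2"
  using suminf_le_const[OF Bessel_summable[OF assms]] Bessel_le[OF assms] by blast

lemma L2_norm_sq_partial_sum:
  "(L2_norm (\<lambda>z. \<Sum>n<N. c n * z ^ n))\<^sup>2 = (\<Sum>n<N. (norm (c n))\<^sup>2)"
proof -
  let ?S = "\<lambda>z. \<Sum>n<N. c n * z ^ n"
  have "L2_norm (\<lambda>z. ?S z - (\<Sum>n<N. fourier_coeff ?S (int n) * z ^ n)) = 0"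
    by (simp add: fourier_coeff_partial_sum L2_norm_def)
  thus ?thesis
    using L2_norm_sq_diff_partial_sum[OF L2_partial_sum[of c N], of N]
    by (simp add: fourier_coeff_partial_sum)
qed

lemma H2_L2: "f \<in> H2 \<Longrightarrow> f \<in> L2"
  by (simp add: H2_def)

lemma H2_coeff_neg: "f \<in> H2 \<Longrightarrow> n < 0 \<Longrightarrow> fourier_coeff f n = 0"
  by (simp add: H2_def)

lemma H2I: "f \<in> L2 \<Longrightarrow> (\<And>n. n < 0 \<Longrightarrow> fourier_coeff f n = 0) \<Longrightarrow> f \<in> H2"
  by (simp add: H2_def)

lemma H2_diff: "f \<in> H2 \<Longrightarrow> g \<in> H2 \<Longrightarrow> (\<lambda>z. f z - g z) \<in> H2"
  by (intro H2I) (simp_all add: L2_diff H2_L2 fourier_coeff_diff L2_integrable H2_coeff_neg)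

lemma H2_add: "f \<in> H2 \<Longrightarrow> g \<in> H2 \<Longrightarrow> (\<lambda>z. f z + g z) \<in> H2"
  by (intro H2I) (simp_all add: L2_add H2_L2 fourier_coeff_add L2_integrable H2_coeff_neg)

lemma H2_cmult: "f \<in> H2 \<Longrightarrow> (\<lambda>z. c * f z) \<in> H2"
  by (intro H2I) (simp_all add: L2_cmult H2_L2 fourier_coeff_cmult H2_coeff_neg)

lemma H2_sum: "(\<And>i. i \<in> A \<Longrightarrow> f i \<in> H2) \<Longrightarrow> (\<lambda>z. \<Sum>i\<in>A. f i z) \<in> H2"
proof (induction A rule: infinite_finite_induct)
  case (insert x A)
  thus ?case by (auto intro: H2_add)
qed (auto simp: fourier_coeff_def intro!: H2I L2_const)

lemma H2_mult_power:
  assumes "f \<in> H2"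
  shows "(\<lambda>z. z ^ m * f z) \<in> H2"
proof (rule H2I)
  show "(\<lambda>z. z ^ m * f z) \<in> L2"
    by (rule L2_bounded_mult[of _ 1]) (use assms H2_L2 in \<open>auto simp: norm_power intro!: AE_I2\<close>)
  show "fourier_coeff (\<lambda>z. z ^ m * f z) n = 0" if "n < 0" for n
    using fourier_coeff_mult_powi[of f "int m" n] H2_coeff_neg[OF assms, of "n - int m"] that
    by (simp add: mult.commute)
qed

lemma H2_mult_poly: "f \<in> H2 \<Longrightarrow> (\<lambda>z. poly p z * f z) \<in> H2"
  unfolding poly_altdef sum_distrib_right mult.assoc
  by (intro H2_sum H2_cmult H2_mult_power)

lemma H2_poly: "poly p \<in> H2"
proof -
  have "(\<lambda>_. 1) \<in> H2"
    using fourier_coeff_power[of 0] by (intro H2I L2_const) auto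
  from H2_mult_poly[OF this, of p] show ?thesis by simp
qed

lemma H2_limit:
  assumes "\<And>j. F j \<in> H2" "f \<in> L2" "(\<lambda>j. L2_norm (\<lambda>z. F j z - f z)) \<longlonglongrightarrow> 0"
  shows "f \<in> H2"
proof (rule H2I[OF assms(2)])
  fix n :: int assume "n < 0"
  thus "fourier_coeff f n = 0"
    using fourier_coeff_tendsto_L2[OF H2_L2[OF assms(1)] assms(2,3), of n]
    by (simp add: H2_coeff_neg[OF assms(1)] LIMSEQ_const_iff)
qed

lemma H2_AE_eqI:
  assumes "f \<in> H2" "g \<in> H2" "\<And>n. fourier_coeff f (int n) = fourier_coeff g (int n)"
  shows "AE z in \<mu>. f z = g z"
proof (rule AE_eq_of_fourier_coeff_eq)
  show "fourier_coeff f n = fourier_coeff g n" for n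
    using assms(3)[of "nat n"] H2_coeff_neg[OF assms(1), of n] H2_coeff_neg[OF assms(2), of n]
    by (cases "n < 0") auto
qed (use assms H2_L2 L2_integrable in auto)

text \<open>
  The partial sums are Cauchy, because the squared norm of a block of the series is the
  corresponding block of \<open>\<Sum>n. |c n|\<^sup>2\<close>.
\<close>

theorem Riesz_Fischer:
  fixes c :: "nat \<Rightarrow> complex"
  assumes "summable (\<lambda>n. (norm (c n))\<^sup>2)"
  obtains g where "g \<in> H2" "\<And>n. fourier_coeff g (int n) = c n"
    "(\<lambda>N. L2_norm (\<lambda>z. g z - (\<Sum>n<N. c n * z ^ n))) \<longlonglongrightarrow> 0"
proof -
  let ?S = "\<lambda>N z. \<Sum>n<N. c n * z ^ n"
  have SH: "?S N \<in> H2" for N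
    by (intro H2I L2_partial_sum) (simp add: fourier_coeff_partial_sum)
  have tail: "(L2_norm (\<lambda>z. ?S N z - ?S M z))\<^sup>2 = (\<Sum>n=M..<N. (norm (c n))\<^sup>2)" if "M \<le> N" for M N
  proof -
    have "?S N z - ?S M z = (\<Sum>n<N. (if M \<le> n then c n else 0) * z ^ n)" for z
    proof -
      have "(\<Sum>n<N. (if M \<le> n then c n else 0) * z ^ n) = (\<Sum>n=M..<N. c n * z ^ n)"
        by (intro sum.mono_neutral_cong_right) auto
      thus ?thesis using that sum_diff_nat_ivl[of 0 M N "\<lambda>n. c n * z ^ n"]
        by (simp add: atLeast0LessThan)
    qed
    hence "(L2_norm (\<lambda>z. ?S N z - ?S M z))\<^sup>2 = (\<Sum>n<N. (norm (if M \<le> n then c n else 0))\<^sup>2)"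
      by (simp add: L2_norm_sq_partial_sum)
    also have "\<dots> = (\<Sum>n=M..<N. (norm (c n))\<^sup>2)"
      by (intro sum.mono_neutral_cong_right) auto
    finally show ?thesis .
  qed
  have Cauchy: "\<exists>K. \<forall>m\<ge>K. \<forall>n\<ge>K. L2_norm (\<lambda>z. ?S m z - ?S n z) < e" if e: "e > 0" for e
  proof -
    have "e\<^sup>2 > 0" using e by simp
    then obtain K where K: "\<And>m n. m \<ge> K \<Longrightarrow> norm (\<Sum>n=m..<n. (norm (c n))\<^sup>2) < e\<^sup>2"
      using assms unfolding summable_Cauchy by blast
    have le: "L2_norm (\<lambda>z. ?S m z - ?S n z) < e" if "n \<ge> K" "n \<le> m" for m n
    proof (rule power2_less_imp_less)
      show "(L2_norm (\<lambda>z. ?S m z - ?S n z))\<^sup>2 < e\<^sup>2"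
        using tail[OF that(2)] K[OF that(1), of m] by simp
    qed (use e in simp)
    have "L2_norm (\<lambda>z. ?S m z - ?S n z) < e" if "n \<ge> K" "m \<ge> K" for m n
      using le[of n m] le[of m n] that L2_norm_minus_commute[of "?S m" "?S n"]
      by (cases "n \<le> m") auto
    thus ?thesis by blast
  qed
  from L2_complete[of ?S, OF L2_partial_sum Cauchy]
  obtain g where g: "g \<in> L2" "(\<lambda>N. L2_norm (\<lambda>z. ?S N z - g z)) \<longlonglongrightarrow> 0" by blast
  show ?thesis
  proof
    show "g \<in> H2" by (rule H2_limit[OF SH g])
    show "(\<lambda>N. L2_norm (\<lambda>z. g z - ?S N z)) \<longlonglongrightarrow> 0"
      using g(2) by (simp add: L2_norm_minus_commute[of g])
    fix n
    have "(\<lambda>N. fourier_coeff (?S N) (int n)) \<longlonglongrightarrow> fourier_coeff g (int n)"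
      by (rule fourier_coeff_tendsto_L2[OF L2_partial_sum g])
    moreover have "\<forall>\<^sub>F N in sequentially. fourier_coeff (?S N) (int n) = c n"
      using eventually_gt_at_top[of n] by eventually_elim (simp add: fourier_coeff_partial_sum)
    hence "(\<lambda>N. fourier_coeff (?S N) (int n)) \<longlonglongrightarrow> c n" by (rule tendsto_eventually)
    ultimately show "fourier_coeff g (int n) = c n" by (rule LIMSEQ_unique)
  qed
qed

lemma H2_partial_sums_tendsto:
  assumes "f \<in> H2"
  shows "(\<lambda>N. L2_norm (\<lambda>z. f z - (\<Sum>n<N. fourier_coeff f (int n) * z ^ n))) \<longlonglongrightarrow> 0"
proof -
  obtain g where g: "g \<in> H2" "\<And>n. fourier_coeff g (int n) = fourier_coeff f (int n)"
    "(\<lambda>N. L2_norm (\<lambda>z. g z - (\<Sum>n<N. fourier_coeff f (int n) * z ^ n))) \<longlonglongrightarrow> 0"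
    using Riesz_Fischer[OF Bessel_summable[OF H2_L2[OF assms]]] by blast
  have "AE z in \<mu>. g z = f z" by (rule H2_AE_eqI) (use g assms in auto)
  hence "L2_norm (\<lambda>z. g z - (\<Sum>n<N. fourier_coeff f (int n) * z ^ n)) =
      L2_norm (\<lambda>z. f z - (\<Sum>n<N. fourier_coeff f (int n) * z ^ n))" for N
    by (intro L2_norm_cong L2_measurable L2_diff L2_partial_sum H2_L2 g assms) auto
  with g(3) show ?thesis by simp
qed

lemma Parseval:
  assumes "f \<in> H2"
  shows "(L2_norm f)\<^sup>2 = (\<Sum>n. (norm (fourier_coeff f (int n)))\<^sup>2)"
proof -
  have "(\<lambda>N. (L2_norm (\<lambda>z. f z - (\<Sum>n<N. fourier_coeff f (int n) * z ^ n)))\<^sup>2) \<longlonglongrightarrow> 0\<^sup>2"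
    by (intro tendsto_power H2_partial_sums_tendsto assms)
  hence "(\<lambda>N. (L2_norm f)\<^sup>2 - (\<Sum>n<N. (norm (fourier_coeff f (int n)))\<^sup>2)) \<longlonglongrightarrow> 0"
    by (simp add: L2_norm_sq_diff_partial_sum H2_L2[OF assms])
  from tendsto_diff[OF tendsto_const[of "(L2_norm f)\<^sup>2"] this]
  have "(\<lambda>n. (norm (fourier_coeff f (int n)))\<^sup>2) sums (L2_norm f)\<^sup>2"
    by (simp add: sums_def)
  thus ?thesis by (simp add: sums_iff)
qed

lemma H2_norm_le_of_coeff:
  assumes "f \<in> H2" "g \<in> L2" "\<And>n. fourier_coeff f (int n) = fourier_coeff g (int n)"
  shows "L2_norm f \<le> L2_norm g"
  by (rule power2_le_imp_le) (use Parseval[OF assms(1)] Bessel_suminf[OF assms(2)] assms(3) in simp_all)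

lemma L2_inner_tendsto_left:
  assumes "\<And>j. F j \<in> L2" "f \<in> L2" "g \<in> L2" "(\<lambda>j. L2_norm (\<lambda>z. F j z - f z)) \<longlonglongrightarrow> 0"
  shows "(\<lambda>j. L2_inner (F j) g) \<longlonglongrightarrow> L2_inner f g"
  using fourier_coeff_tendsto_mult_L2[OF assms(1,2) L2_cnj[OF assms(3)] assms(4), of 0]
  by (simp add: fourier_coeff_def L2_inner_def)

lemma L2_inner_commute: "L2_inner g f = cnj (L2_inner f g)"
  using Bochner_Integration.integral_cnj[of \<mu> "\<lambda>z. f z * cnj (g z)"] by (simp add: L2_inner_def mult.commute)

lemma L2_inner_tendsto_right:
  assumes "\<And>j. F j \<in> L2" "f \<in> L2" "g \<in> L2" "(\<lambda>j. L2_norm (\<lambda>z. F j z - f z)) \<longlonglongrightarrow> 0"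
  shows "(\<lambda>j. L2_inner g (F j)) \<longlonglongrightarrow> L2_inner g f"
  using tendsto_cnj[OF L2_inner_tendsto_left[OF assms]]
  by (simp add: L2_inner_commute[of g])

lemma L2_inner_poly_right:
  assumes "f \<in> L2"
  shows "L2_inner f (poly p) = (\<Sum>i\<le>degree p. cnj (coeff p i) * fourier_coeff f (int i))"
proof -
  have "L2_inner f (poly p) =
      (LINT z|\<mu>. (\<Sum>i\<le>degree p. cnj (coeff p i) * (f z * z powi (- int i))))"
    unfolding L2_inner_def
  proof (rule Bochner_Integration.integral_cong)
    fix z assume "z \<in> space \<mu>"
    hence z: "norm z = 1" by simp
    have "cnj (poly p z) = (\<Sum>i\<le>degree p. cnj (coeff p i) * cnj (z powi int i))"
      by (simp add: poly_altdef)
    thus "f z * cnj (poly p z) = (\<Sum>i\<le>degree p. cnj (coeff p i) * (f z * z powi (- int i)))"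
      unfolding cnj_powi_circle[OF z] by (simp add: sum_distrib_left mult_ac)
  qed simp
  also have "\<dots> = (\<Sum>i\<le>degree p. cnj (coeff p i) * fourier_coeff f (int i))"
    unfolding fourier_coeff_def
    by (subst Bochner_Integration.integral_sum)
       (auto intro!: integrable_mult_right integrable_mult_powi L2_integrable[OF assms]
         simp del: power_int_minus)
  finally show ?thesis .
qed

lemma H2_polynomials_dense:
  assumes "f \<in> H2"
  obtains P where "(\<lambda>j. L2_norm (\<lambda>z. poly (P j) z - f z)) \<longlonglongrightarrow> 0"
proof
  let ?P = "\<lambda>N. \<Sum>n<N. monom (fourier_coeff f (int n)) n"
  show "(\<lambda>j. L2_norm (\<lambda>z. poly (?P j) z - f z)) \<longlonglongrightarrow> 0"
    using H2_partial_sums_tendsto[OF assms]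
    by (simp add: poly_sum poly_monom L2_norm_minus_commute[of f])
qed

text \<open>
  Pairing with an element of \<open>H2\<close> sees only the coefficients of nonnegative index.  With \<open>k\<close> the
  projection of \<open>h\<close>, this removes the projection from pairings with Hankel operators.
\<close>

lemma L2_inner_analytic_part:
  assumes "k \<in> L2" "h \<in> L2" "g \<in> H2" "\<And>n. fourier_coeff k (int n) = fourier_coeff h (int n)"
  shows "L2_inner k g = L2_inner h g"
proof -
  obtain P where P: "(\<lambda>j. L2_norm (\<lambda>z. poly (P j) z - g z)) \<longlonglongrightarrow> 0"
    using H2_polynomials_dense[OF assms(3)] by blast
  have "L2_inner k (poly (P j)) = L2_inner h (poly (P j))" for j
    using assms(4) by (simp add: L2_inner_poly_right assms(1,2))
  moreover have "(\<lambda>j. L2_inner k (poly (P j))) \<longlonglongrightarrow> L2_inner k g"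
    "(\<lambda>j. L2_inner h (poly (P j))) \<longlonglongrightarrow> L2_inner h g"
    by (rule L2_inner_tendsto_right[OF L2_poly H2_L2[OF assms(3)] _ P]; fact)+
  ultimately show ?thesis using LIMSEQ_unique by simp
qed

section \<open>The Hankel operator on its maximal domain\<close>

abbreviation hankel_coeff :: "(complex \<Rightarrow> complex) \<Rightarrow> (complex \<Rightarrow> complex) \<Rightarrow> nat \<Rightarrow> complex" where
  "hankel_coeff u f n \<equiv> fourier_coeff (\<lambda>z. u z * refl_J f z) (int n)"

lemma hankel_dom_H2: "f \<in> hankel_dom u \<Longrightarrow> f \<in> H2"
  by (simp add: hankel_dom_def)

text \<open>
  The operator is defined by choosing a sum of a series.  The Riesz--Fischer theorem provides such a
  sum; everything later uses only that the choice lies in \<open>H2\<close> and has the right coefficients.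
\<close>

lemma
  assumes "f \<in> hankel_dom u"
  shows hankel_H2: "hankel u f \<in> H2"
    and fourier_coeff_hankel: "fourier_coeff (hankel u f) (int n) = hankel_coeff u f n"
proof -
  let ?S = "\<lambda>N z. \<Sum>n<N. hankel_coeff u f n * z ^ n"
  have "summable (\<lambda>n. (norm (hankel_coeff u f n))\<^sup>2)"
    using assms by (simp add: hankel_dom_def)
  from Riesz_Fischer[OF this]
  have ex: "\<exists>g. g \<in> H2 \<and> (\<lambda>N. L2_norm (\<lambda>z. g z - ?S N z)) \<longlonglongrightarrow> 0" by blast
  have *: "hankel u f \<in> H2 \<and> (\<lambda>N. L2_norm (\<lambda>z. hankel u f z - ?S N z)) \<longlonglongrightarrow> 0"
    unfolding hankel_def hardy_proj_def by (rule someI_ex[OF ex])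
  thus "hankel u f \<in> H2" by blast
  have "(\<lambda>N. fourier_coeff (?S N) (int n)) \<longlonglongrightarrow> fourier_coeff (hankel u f) (int n)"
    by (rule fourier_coeff_tendsto_L2)
       (use * H2_L2 L2_partial_sum in \<open>auto simp: L2_norm_minus_commute[of _ "hankel u f"]\<close>)
  moreover have "\<forall>\<^sub>F N in sequentially. fourier_coeff (?S N) (int n) = hankel_coeff u f n"
    using eventually_gt_at_top[of n] by eventually_elim (simp add: fourier_coeff_partial_sum)
  hence "(\<lambda>N. fourier_coeff (?S N) (int n)) \<longlonglongrightarrow> hankel_coeff u f n" by (rule tendsto_eventually)
  ultimately show "fourier_coeff (hankel u f) (int n) = hankel_coeff u f n"
    by (rule LIMSEQ_unique)
qed

lemma hankel_domI:
  assumes "f \<in> H2" "g \<in> L2" "\<And>n. hankel_coeff u f n = fourier_coeff g (int n)"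
  shows "f \<in> hankel_dom u"
  using assms Bessel_summable[OF assms(2)] by (simp add: hankel_dom_def)

lemma hankel_AE_eqI:
  assumes "f \<in> hankel_dom u" "g \<in> H2" "\<And>n. hankel_coeff u f n = fourier_coeff g (int n)"
  shows "AE z in \<mu>. hankel u f z = g z"
  by (rule H2_AE_eqI) (use assms in \<open>auto simp: hankel_H2 fourier_coeff_hankel\<close>)

lemma hankel_coeff_diff:
  assumes "u \<in> L2" "f \<in> L2" "g \<in> L2"
  shows "hankel_coeff u (\<lambda>z. f z - g z) n = hankel_coeff u f n - hankel_coeff u g n"
proof -
  have "(\<lambda>z. u z * refl_J (\<lambda>z. f z - g z) z) = (\<lambda>z. u z * refl_J f z - u z * refl_J g z)"
    by (simp add: refl_J_def right_diff_distrib)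
  thus ?thesis
    using assms by (simp add: fourier_coeff_diff L2_mult_integrable L2_refl_J)
qed

text \<open>
  Linearity of the operator holds only almost everywhere, because the value at a difference is chosen
  independently of the values at the two terms.
\<close>

lemma
  assumes "u \<in> L2" "f \<in> hankel_dom u" "g \<in> hankel_dom u"
  shows hankel_dom_diff: "(\<lambda>z. f z - g z) \<in> hankel_dom u"
    and hankel_diff_AE: "AE z in \<mu>. hankel u (\<lambda>z. f z - g z) z = hankel u f z - hankel u g z"
proof -
  note H = assms(2,3)[THEN hankel_dom_H2] assms(2,3)[THEN hankel_H2]
  have c: "hankel_coeff u (\<lambda>z. f z - g z) n =
      fourier_coeff (\<lambda>z. hankel u f z - hankel u g z) (int n)" for n
    using assms(1) H H[THEN H2_L2]
    by (simp add: hankel_coeff_diff fourier_coeff_diff L2_integrable fourier_coeff_hankel assms)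
  show 1: "(\<lambda>z. f z - g z) \<in> hankel_dom u"
    by (rule hankel_domI[OF H2_diff L2_diff c]) (use H H2_L2 in auto)
  show "AE z in \<mu>. hankel u (\<lambda>z. f z - g z) z = hankel u f z - hankel u g z"
    by (rule hankel_AE_eqI[OF 1 H2_diff c]) (use H in auto)
qed

lemma L2_norm_hankel_diff:
  assumes "u \<in> L2" "f \<in> hankel_dom u" "g \<in> hankel_dom u"
  shows "L2_norm (hankel u (\<lambda>z. f z - g z)) = L2_norm (\<lambda>z. hankel u f z - hankel u g z)"
proof (rule L2_norm_cong)
  show "AE z in \<mu>. norm (hankel u (\<lambda>z. f z - g z) z) = norm (hankel u f z - hankel u g z)"
    using hankel_diff_AE[OF assms] by eventually_elim simp
qed (intro L2_measurable L2_diff H2_L2 hankel_H2 hankel_dom_diff assms)+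

lemma L2_norm_hankel_le:
  assumes "f \<in> hankel_dom u" "g \<in> L2" "\<And>n. hankel_coeff u f n = fourier_coeff g (int n)"
  shows "L2_norm (hankel u f) \<le> L2_norm g"
  by (rule H2_norm_le_of_coeff) (use assms in \<open>auto simp: hankel_H2 fourier_coeff_hankel\<close>)

lemma graph_norm_le: "graph_norm T f \<le> L2_norm f + L2_norm (T f)"
  unfolding graph_norm_def
  using sqrt_add_le_add_sqrt[of "(L2_norm f)\<^sup>2" "(L2_norm (T f))\<^sup>2"] by simp

lemma L2_norm_le_graph_norm:
  "L2_norm f \<le> graph_norm T f" "L2_norm (T f) \<le> graph_norm T f"
  unfolding graph_norm_def by (auto intro: real_le_rsqrt)

lemma hankel_coeff_tendsto:
  assumes "u \<in> L2" "\<And>j. F j \<in> L2" "f \<in> L2" "(\<lambda>j. L2_norm (\<lambda>z. F j z - f z)) \<longlonglongrightarrow> 0"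
  shows "(\<lambda>j. hankel_coeff u (F j) n) \<longlonglongrightarrow> hankel_coeff u f n"
proof -
  have "L2_norm (\<lambda>z. refl_J (F j) z - refl_J f z) = L2_norm (\<lambda>z. F j z - f z)" for j
    using L2_norm_refl_J[OF L2_diff[OF assms(2,3)], of j] by (simp add: refl_J_def[abs_def])
  with assms(4) have "(\<lambda>j. L2_norm (\<lambda>z. refl_J (F j) z - refl_J f z)) \<longlonglongrightarrow> 0"
    by simp
  from fourier_coeff_tendsto_mult_L2[OF L2_refl_J[OF assms(2)] L2_refl_J[OF assms(3)] assms(1) this]
  show ?thesis by (simp add: mult.commute)
qed

text \<open>
  The coefficients of \<open>\<Gamma>\<^sub>u (F j)\<close> tend to those of \<open>u * Jf\<close>, by continuity in \<open>f\<close>, and to those of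
  \<open>g\<close>, by convergence in \<open>L\<^sup>2\<close>.  Membership of \<open>f\<close> in the domain is then Bessel's inequality for \<open>g\<close>.
\<close>

theorem hankel_closed:
  assumes "u \<in> L2"
  shows "closed_operator (hankel_dom u) (hankel u)"
  unfolding closed_operator_def
proof (intro allI impI, elim conjE)
  fix F :: "nat \<Rightarrow> complex \<Rightarrow> complex" and f g
  assume F: "\<forall>n. F n \<in> hankel_dom u" and f: "f \<in> H2" and g: "g \<in> H2"
    and lim: "(\<lambda>n. L2_norm (\<lambda>z. F n z - f z)) \<longlonglongrightarrow> 0"
      "(\<lambda>n. L2_norm (\<lambda>z. hankel u (F n) z - g z)) \<longlonglongrightarrow> 0"
  have FL: "F j \<in> L2" "hankel u (F j) \<in> L2" for j
    using F hankel_dom_H2 hankel_H2 H2_L2 by blast+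
  have c: "hankel_coeff u f n = fourier_coeff g (int n)" for n
  proof (rule LIMSEQ_unique)
    show "(\<lambda>j. hankel_coeff u (F j) n) \<longlonglongrightarrow> hankel_coeff u f n"
      by (rule hankel_coeff_tendsto[OF assms FL(1) H2_L2[OF f] lim(1)])
    show "(\<lambda>j. hankel_coeff u (F j) n) \<longlonglongrightarrow> fourier_coeff g (int n)"
      using fourier_coeff_tendsto_L2[OF FL(2) H2_L2[OF g] lim(2), of "int n"] F
      by (simp add: fourier_coeff_hankel)
  qed
  have "f \<in> hankel_dom u" by (rule hankel_domI[OF f H2_L2[OF g] c])
  thus "f \<in> hankel_dom u \<and> (AE z in \<mu>. hankel u f z = g z)"
    using hankel_AE_eqI[OF _ g c] by blast
qed

theorem hankel_graph_norm_complete: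
  assumes "u \<in> L2"
  shows "graph_norm_complete (hankel_dom u) (hankel u)"
  unfolding graph_norm_complete_def
proof (intro allI impI, elim conjE)
  fix F :: "nat \<Rightarrow> complex \<Rightarrow> complex"
  assume F: "\<forall>n. F n \<in> hankel_dom u"
    and Cauchy: "\<forall>e>0. \<exists>N. \<forall>m\<ge>N. \<forall>n\<ge>N. graph_norm (hankel u) (\<lambda>z. F m z - F n z) < e"
  have FH: "F j \<in> H2" "hankel u (F j) \<in> H2" for j
    using F hankel_dom_H2 hankel_H2 by blast+
  have 1: "\<exists>N. \<forall>m\<ge>N. \<forall>n\<ge>N. L2_norm (\<lambda>z. F m z - F n z) < e" if "e > 0" for e
    using Cauchy that L2_norm_le_graph_norm(1) by (meson le_less_trans)
  have 2: "\<exists>N. \<forall>m\<ge>N. \<forall>n\<ge>N. L2_norm (\<lambda>z. hankel u (F m) z - hankel u (F n) z) < e"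
    if e: "e > 0" for e
  proof -
    obtain N where N: "\<And>m n. m \<ge> N \<Longrightarrow> n \<ge> N \<Longrightarrow> graph_norm (hankel u) (\<lambda>z. F m z - F n z) < e"
      using Cauchy e by blast
    have "L2_norm (\<lambda>z. hankel u (F m) z - hankel u (F n) z) < e" if "m \<ge> N" "n \<ge> N" for m n
      using N[OF that] L2_norm_le_graph_norm(2)[where T = "hankel u" and f = "\<lambda>z. F m z - F n z"]
        L2_norm_hankel_diff[OF assms, of "F m" "F n"] F by simp
    thus ?thesis by blast
  qed
  obtain f where f: "f \<in> L2" "(\<lambda>n. L2_norm (\<lambda>z. F n z - f z)) \<longlonglongrightarrow> 0"
    using L2_complete[of F] 1 FH H2_L2 by blast
  obtain g where g: "g \<in> L2" "(\<lambda>n. L2_norm (\<lambda>z. hankel u (F n) z - g z)) \<longlonglongrightarrow> 0"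
    using L2_complete[of "\<lambda>n. hankel u (F n)"] 2 FH H2_L2 by blast
  have fg: "f \<in> H2" "g \<in> H2" using H2_limit[OF FH(1) f] H2_limit[OF FH(2) g] by auto
  have dom: "f \<in> hankel_dom u" and eq: "AE z in \<mu>. hankel u f z = g z"
    using hankel_closed[OF assms] F fg f(2) g(2) unfolding closed_operator_def by blast+
  have "L2_norm (hankel u (\<lambda>z. F n z - f z)) = L2_norm (\<lambda>z. hankel u (F n) z - g z)" for n
  proof -
    have "L2_norm (hankel u (\<lambda>z. F n z - f z)) = L2_norm (\<lambda>z. hankel u (F n) z - hankel u f z)"
      using F dom by (intro L2_norm_hankel_diff assms) auto
    also have "\<dots> = L2_norm (\<lambda>z. hankel u (F n) z - g z)"
      using eq by (intro L2_norm_cong L2_measurable L2_diff H2_L2 FH hankel_H2 dom fg) auto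
    finally show ?thesis .
  qed
  moreover have "(\<lambda>n. sqrt ((L2_norm (\<lambda>z. F n z - f z))\<^sup>2 +
      (L2_norm (\<lambda>z. hankel u (F n) z - g z))\<^sup>2)) \<longlonglongrightarrow> sqrt (0\<^sup>2 + 0\<^sup>2)"
    by (intro tendsto_intros f g)
  ultimately have "(\<lambda>n. graph_norm (hankel u) (\<lambda>z. F n z - f z)) \<longlonglongrightarrow> 0"
    by (simp add: graph_norm_def)
  thus "\<exists>f\<in>hankel_dom u. (\<lambda>n. graph_norm (hankel u) (\<lambda>z. F n z - f z)) \<longlonglongrightarrow> 0"
    using dom by auto
qed

section \<open>Bounded multipliers from an extremal problem\<close>

lemma norm_poly_circle_le:
  assumes "norm (z :: complex) = 1"
  shows "norm (poly p z) \<le> (\<Sum>i\<le>degree p. norm (coeff p i))"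
  unfolding poly_altdef
  by (rule order_trans[OF norm_sum]) (use assms in \<open>simp add: norm_mult norm_power\<close>)

lemma poly_circle_bounded:
  fixes p :: "complex poly"
  obtains C where "0 \<le> C" "\<And>z. norm z = 1 \<Longrightarrow> norm (poly p z) \<le> C"
  by (rule that[of "\<Sum>i\<le>degree p. norm (coeff p i)"])
     (auto intro: sum_nonneg norm_poly_circle_le)

lemma poly_measurable_circle [measurable]: "poly p \<in> borel_measurable \<mu>"
  by (rule L2_measurable[OF L2_poly])

lemma L2_mult_poly: "f \<in> L2 \<Longrightarrow> (\<lambda>z. poly p z * f z) \<in> L2"
proof -
  assume f: "f \<in> L2"
  obtain C where "\<And>z. norm z = 1 \<Longrightarrow> norm (poly p z) \<le> C" using poly_circle_bounded by blast
  thus ?thesis by (intro L2_bounded_mult[of _ C] f) (auto intro!: AE_I2)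
qed

lemma L2_norm_sq_diff:
  assumes "f \<in> L2" "g \<in> L2"
  shows "(L2_norm (\<lambda>z. f z - g z))\<^sup>2 = (L2_norm f)\<^sup>2 + (L2_norm g)\<^sup>2 - 2 * Re (L2_inner f g)"
proof -
  have int: "integrable \<mu> (\<lambda>z. f z * cnj (g z))"
    by (rule L2_mult_integrable[OF assms(1) L2_cnj[OF assms(2)]])
  have "(L2_norm (\<lambda>z. f z - g z))\<^sup>2 =
      (LINT z|\<mu>. ((norm (f z))\<^sup>2 + (norm (g z))\<^sup>2 - 2 * Re (f z * cnj (g z))))"
    unfolding L2_norm_sq by (simp only: norm_diff_square)
  also have "\<dots> = (L2_norm f)\<^sup>2 + (L2_norm g)\<^sup>2 - 2 * (LINT z|\<mu>. Re (f z * cnj (g z)))"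
    using integrable_Re[OF int] L2_integrable_sq[OF assms(1)] L2_integrable_sq[OF assms(2)]
    by (simp add: L2_norm_sq del: times_complex.sel)
  also have "(LINT z|\<mu>. Re (f z * cnj (g z))) = Re (L2_inner f g)"
    unfolding L2_inner_def by (rule integral_Re[OF int])
  finally show ?thesis .
qed

lemma L2_inner_cmult_right: "L2_inner f (\<lambda>z. c * g z) = cnj c * L2_inner f g"
  unfolding L2_inner_def by (subst integral_mult_right_zero[symmetric]) (simp add: mult_ac)

lemma L2_parallelogram:
  assumes "f \<in> L2" "g \<in> L2"
  shows "(L2_norm (\<lambda>z. f z - g z))\<^sup>2 + (L2_norm (\<lambda>z. f z + g z))\<^sup>2 =
    2 * (L2_norm f)\<^sup>2 + 2 * (L2_norm g)\<^sup>2"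
proof -
  have g': "(\<lambda>z. - g z) \<in> L2" using L2_cmult[OF assms(2), of "-1"] by simp
  have "L2_inner f (\<lambda>z. - g z) = - L2_inner f g" "L2_norm (\<lambda>z. - g z) = L2_norm g"
    by (simp_all add: L2_inner_def L2_norm_def)
  thus ?thesis using L2_norm_sq_diff[OF assms] L2_norm_sq_diff[OF assms(1) g'] by simp
qed

text \<open>
  Szego's extremal problem: find the point \<open>G\<close> of least norm in the closure of the convex set of all
  \<open>s * p\<close> with \<open>p\<close> a polynomial, \<open>p 0 = 1\<close>.  By the parallelogram law a minimising sequence
  converges.  Since \<open>(1 - c * z ^ n) * p\<close> is admissible whenever \<open>p\<close> is and \<open>n > 0\<close>, the first variation
  at the minimum gives \<open>\<langle>G, z ^ n * G\<rangle> = 0\<close>, so \<open>|G|\<^sup>2\<close> has no Fourier coefficient of nonzero index.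
\<close>

theorem extremal_function:
  assumes s: "s \<in> L2"
  obtains G P where "G \<in> L2" "\<And>j. poly (P j) 0 = 1"
    "(\<lambda>j. L2_norm (\<lambda>z. poly (P j) z * s z - G z)) \<longlonglongrightarrow> 0"
    "AE z in \<mu>. (norm (G z))\<^sup>2 = (L2_norm G)\<^sup>2" "L2_norm G \<le> L2_norm s"
proof -
  define N where "N p = (L2_norm (\<lambda>z. poly p z * s z))\<^sup>2" for p
  define m where "m = Inf (N ` {p. poly p 0 = 1})"
  have m_le: "m \<le> N p" if "poly p 0 = 1" for p
    unfolding m_def by (rule cInf_lower) (use that in \<open>auto intro!: bdd_belowI[of _ 0] simp: N_def\<close>)
  have "\<exists>p. poly p 0 = 1 \<and> N p < m + inverse (real (Suc j))" for j
  proof -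
    have "N ` {p. poly p 0 = 1} \<noteq> {}" using poly_1[of 0] by blast
    from cInf_lessD[OF this, of "m + inverse (real (Suc j))"]
    show ?thesis unfolding m_def by auto
  qed
  then obtain P where P: "\<And>j. poly (P j) 0 = 1" "\<And>j. N (P j) < m + inverse (real (Suc j))"
    by metis
  define F where "F j z = poly (P j) z * s z" for j z
  have F: "F j \<in> L2" for j unfolding F_def by (rule L2_mult_poly[OF s])
  have NF: "(L2_norm (F j))\<^sup>2 = N (P j)" for j by (simp add: N_def F_def[abs_def])
  have Nlim: "(\<lambda>j. N (P j)) \<longlonglongrightarrow> m"
  proof (rule tendsto_sandwich[OF _ _ tendsto_const])
    show "(\<lambda>j. m + inverse (real (Suc j))) \<longlonglongrightarrow> m"
      using tendsto_add[OF tendsto_const LIMSEQ_inverse_real_of_nat, of m] by simp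
    show "\<forall>\<^sub>F j in sequentially. m \<le> N (P j)"
      by (intro always_eventually allI m_le P)
    show "\<forall>\<^sub>F j in sequentially. N (P j) \<le> m + inverse (real (Suc j))"
      by (intro always_eventually allI less_imp_le P)
  qed
  have dist: "(L2_norm (\<lambda>z. F i z - F j z))\<^sup>2 \<le> 2 * (N (P i) - m) + 2 * (N (P j) - m)" for i j
  proof -
    \<comment> \<open>The midpoint is admissible, so the infimum \<open>m\<close> bounds its squared norm from below.\<close>
    let ?q = "smult (1/2) (P i + P j)"
    have "(L2_norm (\<lambda>z. F i z + F j z))\<^sup>2 = 4 * N ?q"
    proof -
      have "(\<lambda>z. F i z + F j z) = (\<lambda>z. 2 * (poly ?q z * s z))"
        by (simp add: F_def algebra_simps)
      thus ?thesis
        by (simp add: N_def L2_norm_cmult L2_mult_poly s power_mult_distrib del: poly_smult poly_add)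
    qed
    moreover have "m \<le> N ?q" by (rule m_le) (simp add: P)
    ultimately show ?thesis using L2_parallelogram[OF F F, of i j] by (simp add: NF)
  qed
  have "\<exists>K. \<forall>i\<ge>K. \<forall>j\<ge>K. L2_norm (\<lambda>z. F i z - F j z) < e" if e: "e > 0" for e
  proof -
    have "\<forall>\<^sub>F j in sequentially. N (P j) < m + e\<^sup>2 / 4"
      using e by (intro order_tendstoD(2)[OF Nlim]) simp
    then obtain K where K: "\<And>j. j \<ge> K \<Longrightarrow> N (P j) < m + e\<^sup>2 / 4"
      by (auto simp: eventually_sequentially)
    have "L2_norm (\<lambda>z. F i z - F j z) < e" if "i \<ge> K" "j \<ge> K" for i j
    proof (rule power2_less_imp_less)
      show "(L2_norm (\<lambda>z. F i z - F j z))\<^sup>2 < e\<^sup>2"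
        using dist[of i j] K[OF that(1)] K[OF that(2)] by argo
    qed (use e in simp)
    thus ?thesis by blast
  qed
  from L2_complete[of F, OF F this]
  obtain G where G: "G \<in> L2" and lim: "(\<lambda>j. L2_norm (\<lambda>z. F j z - G z)) \<longlonglongrightarrow> 0" by blast
  have "(\<lambda>j. N (P j)) \<longlonglongrightarrow> (L2_norm G)\<^sup>2"
    using tendsto_power[OF L2_norm_tendsto[OF F G lim], of 2] by (simp add: NF)
  with Nlim have mG: "m = (L2_norm G)\<^sup>2" by (rule LIMSEQ_unique)
  have variation: "m \<le> (L2_norm (\<lambda>z. G z - c * (z ^ n * G z)))\<^sup>2" if n: "n > 0" for n c
  proof -
    let ?Q = "\<lambda>j. (1 - monom c n) * P j" and ?H = "\<lambda>z. G z - c * (z ^ n * G z)"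
    have H: "?H \<in> L2"
      using L2_mult_poly[OF G, of "1 - monom c n"] by (simp add: poly_monom algebra_simps)
    have "(\<lambda>j. L2_norm (\<lambda>z. poly (?Q j) z * s z - ?H z)) \<longlonglongrightarrow> 0"
    proof (rule Lim_null_comparison)
      have "L2_norm (\<lambda>z. poly (?Q j) z * s z - ?H z) \<le> (1 + norm c) * L2_norm (\<lambda>z. F j z - G z)" for j
      proof (rule L2_norm_mono)
        show "AE z in \<mu>. norm (poly (?Q j) z * s z - ?H z) \<le> (1 + norm c) * norm (F j z - G z)"
        proof (rule AE_I2)
          fix z assume "z \<in> space \<mu>"
          hence z: "norm z = 1" by simp
          have "poly (?Q j) z * s z - ?H z = (1 - c * z ^ n) * (F j z - G z)"
            by (simp add: F_def poly_monom algebra_simps)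
          moreover have "norm (1 - c * z ^ n) \<le> 1 + norm c"
            using norm_triangle_ineq4[of 1 "c * z ^ n"] z by (simp add: norm_mult norm_power)
          ultimately show "norm (poly (?Q j) z * s z - ?H z) \<le> (1 + norm c) * norm (F j z - G z)"
            by (simp only: norm_mult) (intro mult_right_mono norm_ge_zero)
        qed
        show "(\<lambda>z. F j z - G z) \<in> L2" by (intro L2_diff F G)
        show "(\<lambda>z. poly (?Q j) z * s z - ?H z) \<in> borel_measurable \<mu>"
          by (rule L2_measurable[OF L2_diff[OF L2_mult_poly[OF s] H]])
      qed simp
      thus "\<forall>\<^sub>F j in sequentially. norm (L2_norm (\<lambda>z. poly (?Q j) z * s z - ?H z))
          \<le> (1 + norm c) * L2_norm (\<lambda>z. F j z - G z)" by simp
      show "(\<lambda>j. (1 + norm c) * L2_norm (\<lambda>z. F j z - G z)) \<longlonglongrightarrow> 0"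
        using tendsto_mult_left[OF lim, of "1 + norm c"] by simp
    qed
    from L2_norm_tendsto[OF L2_mult_poly[OF s] H this]
    have "(\<lambda>j. N (?Q j)) \<longlonglongrightarrow> (L2_norm ?H)\<^sup>2"
      unfolding N_def by (rule tendsto_power)
    moreover have "m \<le> N (?Q j)" for j
      by (rule m_le) (use n P in \<open>simp add: poly_monom\<close>)
    ultimately show ?thesis by (intro LIMSEQ_le_const) auto
  qed
  define g where "g z = complex_of_real ((norm (G z))\<^sup>2)" for z
  have int: "integrable \<mu> g"
    unfolding g_def using L2_integrable_sq[OF G] by (rule integrable_of_real)
  have pos: "fourier_coeff g (int n) = 0" if n: "n > 0" for n
  proof -
    let ?H = "\<lambda>z. z ^ n * G z" and ?a = "fourier_coeff g (int n)"
    have H: "?H \<in> L2" using L2_mult_poly[OF G, of "monom 1 n"] by (simp add: poly_monom)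
    have a: "L2_inner G ?H = ?a"
      unfolding L2_inner_def fourier_coeff_def
    proof (rule Bochner_Integration.integral_cong)
      fix z assume "z \<in> space \<mu>"
      hence "norm z = 1" by simp
      from cnj_powi_circle[OF this, of "int n"]
      show "G z * cnj (?H z) = g z * z powi (- int n)"
        unfolding g_def complex_norm_square by (simp add: mult_ac)
    qed simp
    have H_norm: "L2_norm ?H = L2_norm G"
      by (rule L2_norm_cong) (use G H L2_measurable in \<open>auto simp: norm_mult norm_power intro!: AE_I2\<close>)
    \<comment> \<open>Varying along \<open>c = t * a\<close> gives \<open>0 \<le> - 2 * t * |a|\<^sup>2 + t\<^sup>2 * |a|\<^sup>2 * m\<close> for all real \<open>t\<close>,
      which forces \<open>a = 0\<close>.\<close>
    have "((norm ?a)\<^sup>2)\<^sup>2 \<le> 0 * ((norm ?a)\<^sup>2 * m)"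
    proof (rule quadratic_nonneg_imp)
      fix t :: real
      let ?c = "complex_of_real t * ?a"
      have "L2_inner G (\<lambda>z. ?c * ?H z) = cnj ?c * ?a"
        unfolding a[symmetric] by (rule L2_inner_cmult_right)
      also have "\<dots> = complex_of_real (t * (norm ?a)\<^sup>2)"
        unfolding of_real_mult complex_norm_square by (simp add: mult_ac)
      finally have *: "Re (L2_inner G (\<lambda>z. ?c * ?H z)) = t * (norm ?a)\<^sup>2" by simp
      have "(L2_norm (\<lambda>z. ?c * ?H z))\<^sup>2 = t\<^sup>2 * ((norm ?a)\<^sup>2 * m)"
        using L2_norm_cmult[OF H, of ?c] H_norm by (simp add: norm_mult power_mult_distrib mG)
      thus "0 \<le> 0 - 2 * t * (norm ?a)\<^sup>2 + t\<^sup>2 * ((norm ?a)\<^sup>2 * m)"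
        using variation[OF n, of ?c] L2_norm_sq_diff[OF G L2_cmult[OF H, of ?c]] *
        by (simp add: mG)
    qed (simp add: mG)
    thus ?thesis by simp
  qed
  have neg: "fourier_coeff g (- n) = cnj (fourier_coeff g n)" for n
  proof -
    have "fourier_coeff g (- n) = (LINT z|\<mu>. cnj (g z * z powi (- n)))"
      unfolding fourier_coeff_def
    proof (rule Bochner_Integration.integral_cong)
      fix z assume "z \<in> space \<mu>"
      hence "norm z = 1" by simp
      from cnj_powi_circle[OF this, of "- n"]
      show "g z * z powi - (- n) = cnj (g z * z powi (- n))" by (simp add: g_def)
    qed simp
    also have "\<dots> = cnj (fourier_coeff g n)"
      unfolding fourier_coeff_def by (rule Bochner_Integration.integral_cnj)
    finally show ?thesis .
  qed
  have "AE z in \<mu>. g z = complex_of_real m"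
  proof (rule AE_eq_of_fourier_coeff_eq[OF int])
    fix n :: int
    have c: "fourier_coeff (\<lambda>_. complex_of_real m) n = (if n = 0 then complex_of_real m else 0)"
      using fourier_coeff_cmult[of "of_real m" "\<lambda>_. 1" n] fourier_coeff_power[of 0 n] by auto
    consider "n = 0" | "n > 0" | "n < 0" by linarith
    thus "fourier_coeff g n = fourier_coeff (\<lambda>_. complex_of_real m) n"
    proof cases
      case 1
      have "fourier_coeff g 0 = complex_of_real (LINT z|\<mu>. (norm (G z))\<^sup>2)"
        unfolding fourier_coeff_def g_def
        using integral_of_real[OF L2_integrable_sq[OF G]] by simp
      thus ?thesis using c 1 by (simp add: mG L2_norm_sq)
    next
      case 2
      thus ?thesis using pos[of "nat n"] c by simp
    next
      case 3
      thus ?thesis using pos[of "nat (- n)"] neg[of "- n"] c by simp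
    qed
  qed simp
  hence "AE z in \<mu>. (norm (G z))\<^sup>2 = (L2_norm G)\<^sup>2"
    by eventually_elim (use mG in \<open>simp add: g_def flip: of_real_power\<close>)
  moreover have "L2_norm G \<le> L2_norm s"
    using m_le[of 1] by (simp add: mG N_def)
  moreover have "(\<lambda>j. L2_norm (\<lambda>z. poly (P j) z * s z - G z)) \<longlonglongrightarrow> 0"
    using lim by (simp add: F_def)
  ultimately show ?thesis using that[OF G, of P] P(1) by blast
qed

text \<open>
  Let \<open>G\<close> be the extremal function for \<open>s\<close> with \<open>|s|\<^sup>2 = 1 + \<epsilon> * |v|\<^sup>2\<close>, and \<open>\<psi> = G / s\<close>.  As \<open>|G|\<close> is a
  constant and \<open>s\<close> dominates both 1 and \<open>sqrt \<epsilon> * |v|\<close>, the functions \<open>\<psi>\<close> and \<open>v * \<psi>\<close> are bounded, and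
  convergence of \<open>s * p\<close> to \<open>s * \<psi>\<close> implies convergence of \<open>p\<close> and \<open>v * p\<close>.  The normalisation
  \<open>p 0 = 1\<close> survives in the limit as \<open>\<integral> \<psi> = 1\<close>, whence \<open>\<parallel>\<psi> - 1\<parallel>\<^sup>2 = \<parallel>\<psi>\<parallel>\<^sup>2 - 1 \<le> \<epsilon> * \<parallel>v\<parallel>\<^sup>2\<close>.
\<close>

theorem outer_multiplier:
  assumes v: "v \<in> L2" and \<epsilon>: "\<epsilon> > 0"
  obtains \<psi> P where "\<psi> \<in> L2"
    "AE z in \<mu>. (norm (\<psi> z))\<^sup>2 \<le> 1 + \<epsilon> * (L2_norm v)\<^sup>2"
    "AE z in \<mu>. (norm (v z * \<psi> z))\<^sup>2 \<le> (1 + \<epsilon> * (L2_norm v)\<^sup>2) / \<epsilon>"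
    "(L2_norm (\<lambda>z. \<psi> z - 1))\<^sup>2 \<le> \<epsilon> * (L2_norm v)\<^sup>2"
    "(\<lambda>j. L2_norm (\<lambda>z. poly (P j) z - \<psi> z)) \<longlonglongrightarrow> 0"
    "(\<lambda>j. L2_norm (\<lambda>z. v z * (poly (P j) z - \<psi> z))) \<longlonglongrightarrow> 0"
proof -
  let ?w = "\<lambda>z. 1 + \<epsilon> * (norm (v z))\<^sup>2"
  define s where "s z = complex_of_real (sqrt (?w z))" for z
  have [measurable]: "v \<in> borel_measurable \<mu>" by (rule L2_measurable[OF v])
  have s_sq: "(norm (s z))\<^sup>2 = ?w z" for z
    using \<epsilon> by (simp add: s_def)
  have s_ge: "norm (s z) \<ge> 1" for z
    by (rule power2_le_imp_le) (use s_sq[of z] \<epsilon> in auto)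
  hence s0: "s z \<noteq> 0" for z by (metis norm_zero not_one_le_zero)
  have s: "s \<in> L2"
    using L2_integrable_sq[OF v] unfolding L2_def mem_Collect_eq s_sq
    by (auto simp: s_def[abs_def])
  have s_norm: "(L2_norm s)\<^sup>2 = 1 + \<epsilon> * (L2_norm v)\<^sup>2"
    unfolding L2_norm_sq s_sq using L2_integrable_sq[OF v] circle.prob_space by simp
  have v_le: "norm (v z) \<le> 1 / sqrt \<epsilon> * norm (s z)" for z
  proof (rule power2_le_imp_le)
    have "\<epsilon> * (norm (v z))\<^sup>2 \<le> (norm (s z))\<^sup>2" using s_sq[of z] by simp
    thus "(norm (v z))\<^sup>2 \<le> (1 / sqrt \<epsilon> * norm (s z))\<^sup>2"
      using \<epsilon> by (simp add: power_mult_distrib power_divide field_simps)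
  qed (use \<epsilon> in simp)
  obtain G P where G: "G \<in> L2" and P: "\<And>j. poly (P j) 0 = 1"
    and lim: "(\<lambda>j. L2_norm (\<lambda>z. poly (P j) z * s z - G z)) \<longlonglongrightarrow> 0"
    and AE: "AE z in \<mu>. (norm (G z))\<^sup>2 = (L2_norm G)\<^sup>2" and le: "L2_norm G \<le> L2_norm s"
    by (rule extremal_function[OF s]) (rule that)
  define \<psi> where "\<psi> z = G z / s z" for z
  have G_eq: "G z = \<psi> z * s z" for z using s0[of z] by (simp add: \<psi>_def)
  have [measurable]: "s \<in> borel_measurable \<mu>" "G \<in> borel_measurable \<mu>"
    using s G L2_measurable by auto
  have \<psi>_meas [measurable]: "\<psi> \<in> borel_measurable \<mu>"
    unfolding \<psi>_def[abs_def] by measurable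
  have le_s: "norm (f z) \<le> norm (f z * s z)" "norm (v z * f z) \<le> 1 / sqrt \<epsilon> * norm (f z * s z)"
    for f :: "complex \<Rightarrow> complex" and z
  proof -
    show "norm (f z) \<le> norm (f z * s z)"
      using mult_left_mono[OF s_ge[of z], of "norm (f z)"] by (simp add: norm_mult)
    show "norm (v z * f z) \<le> 1 / sqrt \<epsilon> * norm (f z * s z)"
      using mult_right_mono[OF v_le[of z], of "norm (f z)"] by (simp add: norm_mult mult_ac)
  qed
  have \<psi>: "\<psi> \<in> L2"
    by (rule L2_bound[OF G, of _ 1]) (use le_s(1)[of \<psi>] in \<open>auto simp: G_eq\<close>)
  have G_sq: "AE z in \<mu>. (norm (\<psi> z * s z))\<^sup>2 \<le> 1 + \<epsilon> * (L2_norm v)\<^sup>2"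
    using AE
  proof eventually_elim
    case (elim z)
    have "(L2_norm G)\<^sup>2 \<le> (L2_norm s)\<^sup>2" using le by (intro power_mono) auto
    thus ?case using elim by (simp add: G_eq s_norm)
  qed
  have bound1: "AE z in \<mu>. (norm (\<psi> z))\<^sup>2 \<le> 1 + \<epsilon> * (L2_norm v)\<^sup>2"
    using G_sq
  proof eventually_elim
    case (elim z)
    have "(norm (\<psi> z))\<^sup>2 \<le> (norm (\<psi> z * s z))\<^sup>2" by (intro power_mono le_s) auto
    thus ?case using elim by linarith
  qed
  have bound2: "AE z in \<mu>. (norm (v z * \<psi> z))\<^sup>2 \<le> (1 + \<epsilon> * (L2_norm v)\<^sup>2) / \<epsilon>"
    using G_sq
  proof eventually_elim
    case (elim z)
    have "(norm (v z * \<psi> z))\<^sup>2 \<le> (1 / sqrt \<epsilon> * norm (\<psi> z * s z))\<^sup>2" by (intro power_mono le_s) auto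
    also have "\<dots> = (norm (\<psi> z * s z))\<^sup>2 / \<epsilon>"
      using \<epsilon> by (simp add: power_mult_distrib power_divide del: norm_mult)
    also have "\<dots> \<le> (1 + \<epsilon> * (L2_norm v)\<^sup>2) / \<epsilon>"
      using elim \<epsilon> by (intro divide_right_mono) auto
    finally show ?case .
  qed
  have diff_s: "(poly (P j) z - \<psi> z) * s z = poly (P j) z * s z - G z" for j z
    by (simp add: G_eq algebra_simps)
  have PG: "(\<lambda>z. poly (P j) z * s z - G z) \<in> L2" for j by (intro L2_diff L2_mult_poly s G)
  have lim1: "(\<lambda>j. L2_norm (\<lambda>z. poly (P j) z - \<psi> z)) \<longlonglongrightarrow> 0"
  proof (rule Lim_null_comparison[OF _ lim])
    have "L2_norm (\<lambda>z. poly (P j) z - \<psi> z) \<le> 1 * L2_norm (\<lambda>z. poly (P j) z * s z - G z)" for j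
      by (rule L2_norm_mono[OF PG])
         (use le_s(1)[of "\<lambda>z. poly (P j) z - \<psi> z"] in \<open>auto simp: diff_s\<close>)
    thus "\<forall>\<^sub>F j in sequentially. norm (L2_norm (\<lambda>z. poly (P j) z - \<psi> z))
        \<le> L2_norm (\<lambda>z. poly (P j) z * s z - G z)" by simp
  qed
  have lim2: "(\<lambda>j. L2_norm (\<lambda>z. v z * (poly (P j) z - \<psi> z))) \<longlonglongrightarrow> 0"
  proof (rule Lim_null_comparison)
    have "L2_norm (\<lambda>z. v z * (poly (P j) z - \<psi> z))
        \<le> 1 / sqrt \<epsilon> * L2_norm (\<lambda>z. poly (P j) z * s z - G z)" for j
      by (rule L2_norm_mono[OF PG])
         (use le_s(2)[of _ "\<lambda>z. poly (P j) z - \<psi> z"] \<epsilon> in \<open>auto simp: diff_s\<close>)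
    thus "\<forall>\<^sub>F j in sequentially. norm (L2_norm (\<lambda>z. v z * (poly (P j) z - \<psi> z)))
        \<le> 1 / sqrt \<epsilon> * L2_norm (\<lambda>z. poly (P j) z * s z - G z)" by simp
    show "(\<lambda>j. 1 / sqrt \<epsilon> * L2_norm (\<lambda>z. poly (P j) z * s z - G z)) \<longlonglongrightarrow> 0"
      using tendsto_mult_left[OF lim, of "1 / sqrt \<epsilon>"] by simp
  qed
  have mean: "fourier_coeff \<psi> 0 = 1"
  proof (rule LIMSEQ_unique)
    show "(\<lambda>j. fourier_coeff (poly (P j)) 0) \<longlonglongrightarrow> fourier_coeff \<psi> 0"
      by (rule fourier_coeff_tendsto_L2[OF L2_poly \<psi> lim1])
    have "fourier_coeff (poly p) 0 = poly p 0" for p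
    proof -
      have "fourier_coeff (poly p) 0 = L2_inner (poly p) (poly 1)"
        by (simp add: fourier_coeff_def L2_inner_def)
      also have "\<dots> = cnj (L2_inner (\<lambda>_. 1) (poly p))"
        by (subst L2_inner_commute) (simp add: L2_inner_def)
      also have "\<dots> = poly p 0"
      proof -
        have c: "fourier_coeff (\<lambda>_. 1) (int i) = (if i = 0 then 1 else 0)" for i
          using fourier_coeff_power[of 0 "int i"] by simp
        have "cnj (L2_inner (\<lambda>_. 1) (poly p)) = (\<Sum>i\<le>degree p. if i = 0 then coeff p 0 else 0)"
          unfolding L2_inner_poly_right[OF L2_const] cnj_sum by (intro sum.cong) (auto simp: c)
        thus ?thesis by (simp add: poly_0_coeff_0)
      qed
      finally show ?thesis .
    qed
    thus "(\<lambda>j. fourier_coeff (poly (P j)) 0) \<longlonglongrightarrow> 1" by (simp add: P)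
  qed
  have "(L2_norm (\<lambda>z. \<psi> z - 1))\<^sup>2 = (L2_norm \<psi>)\<^sup>2 + (L2_norm (\<lambda>_. 1))\<^sup>2 - 2 * Re (L2_inner \<psi> (\<lambda>_. 1))"
    by (rule L2_norm_sq_diff[OF \<psi> L2_const])
  also have "L2_inner \<psi> (\<lambda>_. 1) = 1"
    using mean by (simp add: fourier_coeff_def L2_inner_def)
  finally have "(L2_norm (\<lambda>z. \<psi> z - 1))\<^sup>2 = (L2_norm \<psi>)\<^sup>2 - 1" by (simp add: L2_norm_one)
  moreover have "(L2_norm \<psi>)\<^sup>2 \<le> 1 + \<epsilon> * (L2_norm v)\<^sup>2"
  proof -
    have "(L2_norm \<psi>)\<^sup>2 \<le> (LINT z|\<mu>. 1 + \<epsilon> * (L2_norm v)\<^sup>2)"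
      unfolding L2_norm_sq[of \<psi>] by (rule integral_mono_AE) (use L2_integrable_sq[OF \<psi>] bound1 in auto)
    thus ?thesis using circle.prob_space by simp
  qed
  ultimately have "(L2_norm (\<lambda>z. \<psi> z - 1))\<^sup>2 \<le> \<epsilon> * (L2_norm v)\<^sup>2" by simp
  with that[OF \<psi> bound1 bound2 _ lim1 lim2] show ?thesis by blast
qed

text \<open>
  Split \<open>f\<close> at height \<open>M\<close>.  Where \<open>|f| \<le> M\<close> the product is small because \<open>b k\<close> is small in norm, and
  elsewhere it is at most \<open>C\<close> times a tail of \<open>f\<close>, whose norm tends to 0 as \<open>M\<close> grows.
\<close>

lemma L2_norm_bounded_mult_tendsto_zero:
  assumes b: "\<And>k::nat. b k \<in> L2" "\<And>k. AE z in \<mu>. norm (b k z) \<le> C"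
    and lim: "(\<lambda>k. L2_norm (b k)) \<longlonglongrightarrow> 0" and f: "f \<in> L2"
  shows "(\<lambda>k. L2_norm (\<lambda>z. b k z * f z)) \<longlonglongrightarrow> 0"
proof -
  have [measurable]: "b k \<in> borel_measurable \<mu>" "f \<in> borel_measurable \<mu>" for k
    using b f L2_measurable by auto
  define tail where "tail M = (LINT z|\<mu>. indicator {z. real M < norm (f z)} z * (norm (f z))\<^sup>2)" for M
  have int_tail: "integrable \<mu> (\<lambda>z. indicator {z. real M < norm (f z)} z * (norm (f z))\<^sup>2)" for M
    by (rule Bochner_Integration.integrable_bound[OF L2_integrable_sq[OF f]])
       (auto intro!: AE_I2 split: split_indicator)
  have "tail \<longlonglongrightarrow> (LINT z|\<mu>. 0)"
    unfolding tail_def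
  proof (rule integral_dominated_convergence[OF _ _ L2_integrable_sq[OF f]])
    show "AE z in \<mu>. (\<lambda>M. indicator {z. real M < norm (f z)} z * (norm (f z))\<^sup>2) \<longlonglongrightarrow> 0"
    proof (rule AE_I2)
      fix z
      obtain K :: nat where K: "norm (f z) \<le> real K" using real_arch_simple by blast
      have "\<forall>\<^sub>F M in sequentially. indicator {z. real M < norm (f z)} z * (norm (f z))\<^sup>2 = 0"
        using eventually_ge_at_top[of K]
        by eventually_elim (use K in \<open>auto split: split_indicator\<close>)
      thus "(\<lambda>M. indicator {z. real M < norm (f z)} z * (norm (f z))\<^sup>2) \<longlonglongrightarrow> 0"
        by (rule tendsto_eventually)
    qed
  qed (auto split: split_indicator)
  hence tail0: "tail \<longlonglongrightarrow> 0" by simp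
  have le: "(L2_norm (\<lambda>z. b k z * f z))\<^sup>2 \<le> (real M)\<^sup>2 * (L2_norm (b k))\<^sup>2 + C\<^sup>2 * tail M" for k M
  proof -
    have "(L2_norm (\<lambda>z. b k z * f z))\<^sup>2 \<le> (LINT z|\<mu>. (real M)\<^sup>2 * (norm (b k z))\<^sup>2 +
        C\<^sup>2 * (indicator {z. real M < norm (f z)} z * (norm (f z))\<^sup>2))"
      unfolding L2_norm_sq
    proof (rule integral_mono_AE)
      show "integrable \<mu> (\<lambda>z. (norm (b k z * f z))\<^sup>2)"
        by (rule L2_integrable_sq[OF L2_bounded_mult[OF _ b(2) f]]) measurable
      show "AE z in \<mu>. (norm (b k z * f z))\<^sup>2 \<le> (real M)\<^sup>2 * (norm (b k z))\<^sup>2 +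
          C\<^sup>2 * (indicator {z. real M < norm (f z)} z * (norm (f z))\<^sup>2)"
        using b(2)[of k]
      proof eventually_elim
        case (elim z)
        show ?case
        proof (cases "real M < norm (f z)")
          case True
          have "(norm (b k z))\<^sup>2 \<le> C\<^sup>2" using elim by (intro power_mono) auto
          hence "(norm (b k z))\<^sup>2 * (norm (f z))\<^sup>2 \<le> C\<^sup>2 * (norm (f z))\<^sup>2"
            by (intro mult_right_mono) auto
          thus ?thesis using True by (simp add: norm_mult power_mult_distrib add_increasing)
        next
          case False
          hence "(norm (f z))\<^sup>2 \<le> (real M)\<^sup>2" by (intro power_mono) auto
          hence "(norm (f z))\<^sup>2 * (norm (b k z))\<^sup>2 \<le> (real M)\<^sup>2 * (norm (b k z))\<^sup>2"
            by (intro mult_right_mono) auto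
          thus ?thesis using False by (simp add: norm_mult power_mult_distrib mult.commute)
        qed
      qed
    qed (use int_tail L2_integrable_sq[OF b(1)] in auto)
    also have "\<dots> = (real M)\<^sup>2 * (L2_norm (b k))\<^sup>2 + C\<^sup>2 * tail M"
      using int_tail L2_integrable_sq[OF b(1)] by (simp add: L2_norm_sq tail_def)
    finally show ?thesis .
  qed
  have "(\<lambda>k. (L2_norm (\<lambda>z. b k z * f z))\<^sup>2) \<longlonglongrightarrow> 0"
  proof (rule LIMSEQ_I)
    fix e :: real assume e: "e > 0"
    have "(\<lambda>M. C\<^sup>2 * tail M) \<longlonglongrightarrow> 0" using tendsto_mult_left[OF tail0, of "C\<^sup>2"] by simp
    hence "\<forall>\<^sub>F M in sequentially. C\<^sup>2 * tail M < e / 2"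
      using e by (intro order_tendstoD(2)) auto
    then obtain M where M: "C\<^sup>2 * tail M < e / 2" by (auto dest: eventually_happens)
    have "(\<lambda>k. (real M)\<^sup>2 * (L2_norm (b k))\<^sup>2) \<longlonglongrightarrow> (real M)\<^sup>2 * 0\<^sup>2"
      by (intro tendsto_intros lim)
    hence "\<forall>\<^sub>F k in sequentially. (real M)\<^sup>2 * (L2_norm (b k))\<^sup>2 < e / 2"
      using e by (intro order_tendstoD(2)) auto
    then obtain K where K: "\<And>k. k \<ge> K \<Longrightarrow> (real M)\<^sup>2 * (L2_norm (b k))\<^sup>2 < e / 2"
      by (auto simp: eventually_sequentially)
    have "(L2_norm (\<lambda>z. b k z * f z))\<^sup>2 < e" if "k \<ge> K" for k
      using le[of k M] K[OF that] M by linarith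
    thus "\<exists>K. \<forall>k\<ge>K. norm ((L2_norm (\<lambda>z. b k z * f z))\<^sup>2 - 0) < e" by auto
  qed
  from tendsto_real_sqrt[OF this] show ?thesis by simp
qed

section \<open>Density of the polynomials\<close>

text \<open>
  On the circle \<open>J\<close> turns \<open>z ^ i\<close> into \<open>z powi (- i)\<close>, so that multiplication by \<open>Jp\<close> only moves
  coefficients downwards: those of nonnegative index of the product are determined by those of
  nonnegative index of \<open>h\<close>.
\<close>

lemma fourier_coeff_mult_refl_J_poly:
  assumes "integrable \<mu> h"
  shows "fourier_coeff (\<lambda>z. refl_J (poly p) z * h z) n =
    (\<Sum>i\<le>degree p. coeff p i * fourier_coeff h (n + int i))"
proof -
  have "fourier_coeff (\<lambda>z. refl_J (poly p) z * h z) n =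
      fourier_coeff (\<lambda>z. \<Sum>i\<le>degree p. coeff p i * (h z * z powi (- int i))) n"
    unfolding fourier_coeff_def
  proof (rule Bochner_Integration.integral_cong)
    fix z assume "z \<in> space \<mu>"
    hence z: "norm z = 1" by simp
    have "refl_J (poly p) z = (\<Sum>i\<le>degree p. coeff p i * cnj (z powi int i))"
      by (simp add: poly_altdef refl_J_def)
    thus "refl_J (poly p) z * h z * z powi - n =
        (\<Sum>i\<le>degree p. coeff p i * (h z * z powi - int i)) * z powi - n"
      unfolding cnj_powi_circle[OF z] by (simp add: sum_distrib_left mult_ac)
  qed simp
  also have "\<dots> = (\<Sum>i\<le>degree p. fourier_coeff (\<lambda>z. coeff p i * (h z * z powi (- int i))) n)"
    by (rule fourier_coeff_sum) (intro integrable_mult_right integrable_mult_powi assms)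
  also have "\<dots> = (\<Sum>i\<le>degree p. coeff p i * fourier_coeff h (n + int i))"
    unfolding fourier_coeff_cmult fourier_coeff_mult_powi by simp
  finally show ?thesis .
qed

text \<open>
  If \<open>u * Jf\<close> is square-integrable, the projection is the orthogonal one and hence a contraction.  The
  condition is stated for \<open>Ju * f = J(u * Jf)\<close>, which is the form in which the multipliers control it.
\<close>

lemma
  assumes "f \<in> H2" "(\<lambda>z. refl_J u z * f z) \<in> L2"
  shows hankel_dom_of_L2: "f \<in> hankel_dom u"
    and L2_norm_hankel_le_of_L2: "L2_norm (hankel u f) \<le> L2_norm (\<lambda>z. refl_J u z * f z)"
proof -
  have J: "refl_J (\<lambda>z. refl_J u z * f z) = (\<lambda>z. u z * refl_J f z)"
    by (simp add: refl_J_def[abs_def])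
  have L: "(\<lambda>z. u z * refl_J f z) \<in> L2"
    using L2_refl_J[OF assms(2)] by (simp add: J)
  show 1: "f \<in> hankel_dom u" by (rule hankel_domI[OF assms(1) L refl])
  show "L2_norm (hankel u f) \<le> L2_norm (\<lambda>z. refl_J u z * f z)"
    using L2_norm_hankel_le[OF 1 L refl] L2_norm_refl_J[OF assms(2)] by (simp add: J)
qed

lemma poly_in_hankel_dom: "u \<in> L2 \<Longrightarrow> poly p \<in> hankel_dom u"
  using L2_mult_poly[OF L2_refl_J, of u p]
  by (intro hankel_dom_of_L2[OF H2_poly]) (simp add: mult.commute)

text \<open>
  The identity \<open>\<Gamma>\<^sub>u (\<psi> * f) = P (J\<psi> * \<Gamma>\<^sub>u f)\<close> is clear for polynomials \<open>\<psi>\<close>, because \<open>u * Jf\<close> and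
  \<open>\<Gamma>\<^sub>u f\<close> have the same coefficients of nonnegative index.  It passes to the limit since
  \<open>u * JP \<longlongrightarrow> u * J\<psi>\<close> and \<open>JP \<longlongrightarrow> J\<psi>\<close> in \<open>L\<^sup>2\<close>; boundedness of \<open>\<psi>\<close> keeps \<open>J\<psi> * \<Gamma>\<^sub>u f\<close> in \<open>L\<^sup>2\<close>.
\<close>

lemma hankel_mult:
  assumes u: "u \<in> L2" and f: "f \<in> hankel_dom u"
    and \<psi>: "\<psi> \<in> L2" "AE z in \<mu>. norm (\<psi> z) \<le> C"
    and v\<psi>: "(\<lambda>z. refl_J u z * \<psi> z) \<in> L2"
    and lim: "(\<lambda>j. L2_norm (\<lambda>z. poly (P j) z - \<psi> z)) \<longlonglongrightarrow> 0"
      "(\<lambda>j. L2_norm (\<lambda>z. refl_J u z * (poly (P j) z - \<psi> z))) \<longlonglongrightarrow> 0"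
  shows "(\<lambda>z. \<psi> z * f z) \<in> hankel_dom u"
    and "hankel_coeff u (\<lambda>z. \<psi> z * f z) n = fourier_coeff (\<lambda>z. refl_J \<psi> z * hankel u f z) (int n)"
proof -
  note fH = hankel_dom_H2[OF f] and gH = hankel_H2[OF f]
  note fL = H2_L2[OF fH] and gL = H2_L2[OF gH]
  have J\<psi>: "AE z in \<mu>. norm (refl_J \<psi> z) \<le> C"
    using AE_cnj_circle[OF \<psi>(2)] by (simp add: refl_J_def)
  have \<psi>f: "(\<lambda>z. \<psi> z * f z) \<in> H2"
  proof (rule H2I)
    show "(\<lambda>z. \<psi> z * f z) \<in> L2"
      by (rule L2_bounded_mult[OF L2_measurable[OF \<psi>(1)] \<psi>(2) fL])
    fix n :: int assume n: "n < 0"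
    have "(\<lambda>j. fourier_coeff (\<lambda>z. poly (P j) z * f z) n) \<longlonglongrightarrow> fourier_coeff (\<lambda>z. \<psi> z * f z) n"
      by (rule fourier_coeff_tendsto_mult_L2[OF L2_poly \<psi>(1) fL lim(1)])
    thus "fourier_coeff (\<lambda>z. \<psi> z * f z) n = 0"
      by (simp add: H2_coeff_neg[OF H2_mult_poly[OF fH] n] LIMSEQ_const_iff)
  qed
  have eq: "hankel_coeff u (\<lambda>z. \<psi> z * f z) n = fourier_coeff (\<lambda>z. refl_J \<psi> z * hankel u f z) (int n)" for n
  proof (rule LIMSEQ_unique)
    let ?h = "\<lambda>z. u z * refl_J f z"
    have h: "integrable \<mu> ?h" by (intro L2_mult_integrable u L2_refl_J fL)
    let ?F = "\<lambda>j z. u z * refl_J (poly (P j)) z" and ?F' = "\<lambda>z. u z * refl_J \<psi> z"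
    have FJ: "?F j = refl_J (\<lambda>z. poly (P j) z * refl_J u z)" for j
      by (auto simp: refl_J_def mult.commute)
    have F'J: "?F' = refl_J (\<lambda>z. refl_J u z * \<psi> z)"
      by (auto simp: refl_J_def)
    have F: "?F j \<in> L2" for j unfolding FJ by (intro L2_refl_J L2_mult_poly u)
    have F': "?F' \<in> L2" unfolding F'J by (intro L2_refl_J v\<psi>)
    have "L2_norm (\<lambda>z. ?F j z - ?F' z) = L2_norm (\<lambda>z. refl_J u z * (poly (P j) z - \<psi> z))" for j
    proof -
      have d: "(\<lambda>z. refl_J u z * (poly (P j) z - \<psi> z)) \<in> L2"
        using L2_diff[OF L2_mult_poly[OF L2_refl_J[OF u], of "P j"] v\<psi>] by (simp add: algebra_simps)
      have "(\<lambda>z. ?F j z - ?F' z) = refl_J (\<lambda>z. refl_J u z * (poly (P j) z - \<psi> z))"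
        by (auto simp: refl_J_def algebra_simps)
      thus ?thesis by (simp only: L2_norm_refl_J[OF d])
    qed
    hence "(\<lambda>j. L2_norm (\<lambda>z. ?F j z - ?F' z)) \<longlonglongrightarrow> 0" using lim(2) by simp
    from fourier_coeff_tendsto_mult_L2[OF F F' L2_refl_J[OF fL] this, of "int n"]
    have "(\<lambda>j. fourier_coeff (\<lambda>z. refl_J (poly (P j)) z * ?h z) (int n))
        \<longlonglongrightarrow> fourier_coeff (\<lambda>z. ?F' z * refl_J f z) (int n)"
      by (simp add: mult_ac)
    moreover have "(\<lambda>z. ?F' z * refl_J f z) = (\<lambda>z. u z * refl_J (\<lambda>z. \<psi> z * f z) z)"
      by (simp add: refl_J_def mult_ac)
    moreover have "fourier_coeff (\<lambda>z. refl_J (poly (P j)) z * ?h z) (int n) =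
        fourier_coeff (\<lambda>z. refl_J (poly (P j)) z * hankel u f z) (int n)" for j
      unfolding fourier_coeff_mult_refl_J_poly[OF h]
        fourier_coeff_mult_refl_J_poly[OF L2_integrable[OF gL]] of_nat_add[symmetric]
        fourier_coeff_hankel[OF f] ..
    ultimately show "(\<lambda>j. fourier_coeff (\<lambda>z. refl_J (poly (P j)) z * hankel u f z) (int n))
        \<longlonglongrightarrow> hankel_coeff u (\<lambda>z. \<psi> z * f z) n" by (simp only:)
    have "L2_norm (\<lambda>z. refl_J (poly (P j)) z - refl_J \<psi> z) = L2_norm (\<lambda>z. poly (P j) z - \<psi> z)" for j
      using L2_norm_refl_J[OF L2_diff[OF L2_poly \<psi>(1)], of "P j"] by (simp add: refl_J_def[abs_def])
    hence "(\<lambda>j. L2_norm (\<lambda>z. refl_J (poly (P j)) z - refl_J \<psi> z)) \<longlonglongrightarrow> 0" using lim(1) by simp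
    from fourier_coeff_tendsto_mult_L2[OF L2_refl_J[OF L2_poly] L2_refl_J[OF \<psi>(1)] gL this]
    show "(\<lambda>j. fourier_coeff (\<lambda>z. refl_J (poly (P j)) z * hankel u f z) (int n))
        \<longlonglongrightarrow> fourier_coeff (\<lambda>z. refl_J \<psi> z * hankel u f z) (int n)" .
  qed
  show "hankel_coeff u (\<lambda>z. \<psi> z * f z) n = fourier_coeff (\<lambda>z. refl_J \<psi> z * hankel u f z) (int n)"
    by (rule eq)
  show "(\<lambda>z. \<psi> z * f z) \<in> hankel_dom u"
    by (rule hankel_domI[OF \<psi>f L2_bounded_mult[OF L2_measurable[OF L2_refl_J[OF \<psi>(1)]] J\<psi> gL] eq])
qed

lemma hankel_diff_le:
  assumes "u \<in> L2" "f \<in> hankel_dom u" "g \<in> hankel_dom u" "(\<lambda>z. refl_J u z * (f z - g z)) \<in> L2"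
  shows "L2_norm (\<lambda>z. hankel u f z - hankel u g z) \<le> L2_norm (\<lambda>z. refl_J u z * (f z - g z))"
  using L2_norm_hankel_le_of_L2[OF H2_diff assms(4)] assms(2,3)[THEN hankel_dom_H2]
    L2_norm_hankel_diff[OF assms(1-3)] by simp

text \<open>
  The polynomial is \<open>q * r\<close>, reached through the chain \<open>f\<close>, \<open>\<phi> * f\<close>, \<open>\<phi> * r\<close>, \<open>q * r\<close>, where \<open>\<phi>\<close> is a bounded
  multiplier close to 1, \<open>r\<close> approximates \<open>f\<close> in \<open>L\<^sup>2\<close>, and \<open>q\<close> approximates \<open>\<phi>\<close>.  The order of the
  choices matters: the accuracy of \<open>r\<close> depends on the bounds for \<open>\<phi>\<close> and \<open>v * \<phi>\<close>, and that of \<open>q\<close> on the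
  maximum of \<open>r\<close> on the circle.
\<close>

theorem hankel_polynomials_dense:
  assumes u: "u \<in> L2" and f: "f \<in> hankel_dom u" and e: "e > 0"
  obtains p where "L2_norm (\<lambda>z. f z - poly p z)
      + L2_norm (\<lambda>z. hankel u f z - hankel u (poly p) z) < e"
proof -
  define v where "v = refl_J u"
  have v: "v \<in> L2" unfolding v_def by (rule L2_refl_J[OF u])
  note fH = hankel_dom_H2[OF f] and gH = hankel_H2[OF f]
  note fL = H2_L2[OF fH] and gL = H2_L2[OF gH]
  let ?\<epsilon> = "\<lambda>k. inverse (real (Suc k))"
  define Q where "Q k \<psi> P \<longleftrightarrow> \<psi> \<in> L2 \<and>
      (AE z in \<mu>. (norm (\<psi> z))\<^sup>2 \<le> 1 + ?\<epsilon> k * (L2_norm v)\<^sup>2) \<and>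
      (AE z in \<mu>. (norm (v z * \<psi> z))\<^sup>2 \<le> (1 + ?\<epsilon> k * (L2_norm v)\<^sup>2) / ?\<epsilon> k) \<and>
      (L2_norm (\<lambda>z. \<psi> z - 1))\<^sup>2 \<le> ?\<epsilon> k * (L2_norm v)\<^sup>2 \<and>
      (\<lambda>j. L2_norm (\<lambda>z. poly (P j) z - \<psi> z)) \<longlonglongrightarrow> 0 \<and>
      (\<lambda>j. L2_norm (\<lambda>z. v z * (poly (P j) z - \<psi> z))) \<longlonglongrightarrow> 0" for k \<psi> P
  have "\<exists>\<psi> P. Q k \<psi> P" for k
    unfolding Q_def by (rule outer_multiplier[OF v, of "?\<epsilon> k"]) (simp, blast)
  then obtain \<psi> P where Q: "Q k (\<psi> k) (P k)" for k
    by metis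
  have \<psi>: "\<psi> k \<in> L2"
    and b1: "AE z in \<mu>. (norm (\<psi> k z))\<^sup>2 \<le> 1 + ?\<epsilon> k * (L2_norm v)\<^sup>2"
    and b2: "AE z in \<mu>. (norm (v z * \<psi> k z))\<^sup>2 \<le> (1 + ?\<epsilon> k * (L2_norm v)\<^sup>2) / ?\<epsilon> k"
    and near: "(L2_norm (\<lambda>z. \<psi> k z - 1))\<^sup>2 \<le> ?\<epsilon> k * (L2_norm v)\<^sup>2"
    and lim1: "(\<lambda>j. L2_norm (\<lambda>z. poly (P k j) z - \<psi> k z)) \<longlonglongrightarrow> 0"
    and lim2: "(\<lambda>j. L2_norm (\<lambda>z. v z * (poly (P k j) z - \<psi> k z))) \<longlonglongrightarrow> 0" for k
    using Q[of k] unfolding Q_def by blast+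
  \<comment> \<open>The bound \<open>B\<close> is common to all multipliers, as the convergence of \<open>\<psi> k * f\<close> requires; the bound for
    \<open>v * \<psi> k\<close> is allowed to grow with \<open>k\<close>.\<close>
  define B where "B = sqrt (1 + (L2_norm v)\<^sup>2)"
  have B0: "0 \<le> B" by (simp add: B_def)
  have B: "AE z in \<mu>. norm (\<psi> k z) \<le> B" for k
    using b1[of k]
  proof eventually_elim
    case (elim z)
    have "?\<epsilon> k * (L2_norm v)\<^sup>2 \<le> 1 * (L2_norm v)\<^sup>2"
      by (intro mult_right_mono) (auto simp: field_simps)
    thus ?case unfolding B_def by (intro real_le_rsqrt) (use elim in linarith)
  qed
  let ?b = "\<lambda>k z. \<psi> k z - 1"
  have b: "?b k \<in> L2" for k by (intro L2_diff \<psi> L2_const)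
  have bB: "AE z in \<mu>. norm (?b k z) \<le> B + 1" for k
    using B[of k] by eventually_elim (use norm_triangle_ineq4[of _ "1::complex"] in \<open>fastforce intro: order_trans\<close>)
  have b0: "(\<lambda>k. L2_norm (?b k)) \<longlonglongrightarrow> 0"
  proof -
    have "(\<lambda>k. (L2_norm (?b k))\<^sup>2) \<longlonglongrightarrow> 0"
    proof (rule Lim_null_comparison)
      show "\<forall>\<^sub>F k in sequentially. norm ((L2_norm (?b k))\<^sup>2) \<le> ?\<epsilon> k * (L2_norm v)\<^sup>2"
        using near by simp
      show "(\<lambda>k. ?\<epsilon> k * (L2_norm v)\<^sup>2) \<longlonglongrightarrow> 0"
        using tendsto_mult_right[OF LIMSEQ_inverse_real_of_nat, of "(L2_norm v)\<^sup>2"] by simp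
    qed
    from tendsto_real_sqrt[OF this] show ?thesis by simp
  qed
  have near1: "(\<lambda>k. L2_norm (\<lambda>z. ?b k z * f z)) \<longlonglongrightarrow> 0"
    by (rule L2_norm_bounded_mult_tendsto_zero[OF b bB b0 fL])
  have Jb: "refl_J (?b k) \<in> L2" "AE z in \<mu>. norm (refl_J (?b k) z) \<le> B + 1"
    "L2_norm (refl_J (?b k)) = L2_norm (?b k)" for k
    using L2_refl_J[OF b] AE_cnj_circle[OF bB] L2_norm_refl_J[OF b] by (auto simp: refl_J_def)
  have near2: "(\<lambda>k. L2_norm (\<lambda>z. refl_J (?b k) z * hankel u f z)) \<longlonglongrightarrow> 0"
    by (rule L2_norm_bounded_mult_tendsto_zero[OF Jb(1,2) _ gL]) (simp add: Jb(3) b0)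
  have "\<forall>\<^sub>F k in sequentially. L2_norm (\<lambda>z. ?b k z * f z) < e / 6 \<and>
      L2_norm (\<lambda>z. refl_J (?b k) z * hankel u f z) < e / 6"
    using e by (intro eventually_conj order_tendstoD(2)[OF near1] order_tendstoD(2)[OF near2]) auto
  then obtain k where k: "L2_norm (\<lambda>z. ?b k z * f z) < e / 6"
    "L2_norm (\<lambda>z. refl_J (?b k) z * hankel u f z) < e / 6"
    by (auto dest: eventually_happens)
  define \<phi> where "\<phi> = \<psi> k"
  have \<phi>: "\<phi> \<in> L2" and \<phi>B: "AE z in \<mu>. norm (\<phi> z) \<le> B"
    using \<psi> B by (auto simp: \<phi>_def)
  define D where "D = sqrt ((1 + ?\<epsilon> k * (L2_norm v)\<^sup>2) / ?\<epsilon> k)"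
  have D0: "0 \<le> D" by (simp add: D_def)
  have D: "AE z in \<mu>. norm (v z * \<phi> z) \<le> D"
    using b2[of k] unfolding \<phi>_def by eventually_elim (auto simp: D_def intro: real_le_rsqrt)
  have [measurable]: "v \<in> borel_measurable \<mu>" "\<phi> \<in> borel_measurable \<mu>"
    using v \<phi> L2_measurable by auto
  have v\<phi>: "(\<lambda>z. v z * \<phi> z) \<in> L2" by (rule L2_bounded[OF _ D]) measurable
  note limP = lim1[of k, folded \<phi>_def] lim2[of k, folded \<phi>_def]
  note mult = hankel_mult[OF u _ \<phi> \<phi>B v\<phi>[unfolded v_def] limP[unfolded v_def]]

  \<comment> \<open>From \<open>f\<close> to \<open>\<phi> * f\<close>: the first difference is a product with \<open>\<phi> - 1\<close>, the
    second is the analytic part of a product with its reflection.\<close>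
  have d1: "L2_norm (\<lambda>z. f z - \<phi> z * f z) < e / 6"
  proof -
    have "L2_norm (\<lambda>z. f z - \<phi> z * f z) = L2_norm (\<lambda>z. ?b k z * f z)"
      using L2_norm_minus_commute[of f "\<lambda>z. \<phi> z * f z"] by (simp add: \<phi>_def algebra_simps)
    thus ?thesis using k by simp
  qed
  have h1: "L2_norm (\<lambda>z. hankel u f z - hankel u (\<lambda>z. \<phi> z * f z) z) < e / 6"
  proof -
    have L: "(\<lambda>z. refl_J (?b k) z * hankel u f z) \<in> L2"
      by (rule L2_bounded_mult[OF L2_measurable[OF Jb(1)] Jb(2) gL])
    have "L2_norm (\<lambda>z. hankel u (\<lambda>z. \<phi> z * f z) z - hankel u f z)
        \<le> L2_norm (\<lambda>z. refl_J (?b k) z * hankel u f z)"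
    proof (rule H2_norm_le_of_coeff[OF H2_diff[OF hankel_H2[OF mult(1)[OF f]] gH] L])
      fix n
      have eq: "(\<lambda>z. refl_J (?b k) z * hankel u f z) =
          (\<lambda>z. refl_J \<phi> z * hankel u f z - hankel u f z)"
        by (simp add: refl_J_def \<phi>_def algebra_simps)
      have "(\<lambda>z. refl_J \<phi> z * hankel u f z) \<in> L2"
        using L2_add[OF L gL] by (simp add: refl_J_def \<phi>_def algebra_simps)
      thus "fourier_coeff (\<lambda>z. hankel u (\<lambda>z. \<phi> z * f z) z - hankel u f z) (int n) =
          fourier_coeff (\<lambda>z. refl_J (?b k) z * hankel u f z) (int n)"
        unfolding eq using mult[OF f]
        by (simp add: fourier_coeff_diff L2_integrable gL H2_L2 hankel_H2 fourier_coeff_hankel)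
    qed
    thus ?thesis using k L2_norm_minus_commute[of "hankel u f"] by simp
  qed

  \<comment> \<open>From \<open>\<phi> * f\<close> to \<open>\<phi> * r\<close>: multiplication by \<open>\<phi>\<close> and by \<open>v * \<phi>\<close> is bounded.\<close>
  obtain R where R: "(\<lambda>j. L2_norm (\<lambda>z. poly (R j) z - f z)) \<longlonglongrightarrow> 0"
    by (rule H2_polynomials_dense[OF fH])
  have "(\<lambda>j. (B + D) * L2_norm (\<lambda>z. poly (R j) z - f z)) \<longlonglongrightarrow> 0"
    using tendsto_mult_left[OF R, of "B + D"] by simp
  hence "\<forall>\<^sub>F j in sequentially. (B + D) * L2_norm (\<lambda>z. poly (R j) z - f z) < e / 3"
    using e by (intro order_tendstoD(2)) auto
  then obtain r where "(B + D) * L2_norm (\<lambda>z. poly r z - f z) < e / 3"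
    by (auto dest: eventually_happens)
  hence r: "(B + D) * L2_norm (\<lambda>z. f z - poly r z) < e / 3"
    by (simp add: L2_norm_minus_commute[of f])
  note rdom = poly_in_hankel_dom[OF u, of r]
  have fr: "(\<lambda>z. f z - poly r z) \<in> L2" by (intro L2_diff fL L2_poly)
  have meas [measurable]: "f \<in> borel_measurable \<mu>" by (rule L2_measurable[OF fL])
  have d2: "L2_norm (\<lambda>z. \<phi> z * f z - \<phi> z * poly r z) \<le> B * L2_norm (\<lambda>z. f z - poly r z)"
  proof (rule L2_norm_mono[OF fr _ B0])
    show "AE z in \<mu>. norm (\<phi> z * f z - \<phi> z * poly r z) \<le> B * norm (f z - poly r z)"
      using \<phi>B by eventually_elim
        (simp add: norm_mult mult_right_mono flip: right_diff_distrib)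
  qed measurable
  have AEv: "AE z in \<mu>. norm (v z * (\<phi> z * f z - \<phi> z * poly r z)) \<le> D * norm (f z - poly r z)"
    using D
  proof eventually_elim
    case (elim z)
    have "v z * (\<phi> z * f z - \<phi> z * poly r z) = (v z * \<phi> z) * (f z - poly r z)"
      by (simp add: algebra_simps)
    thus ?case using elim by (simp only: norm_mult[of "v z * \<phi> z"]) (intro mult_right_mono norm_ge_zero)
  qed
  have h2: "L2_norm (\<lambda>z. hankel u (\<lambda>z. \<phi> z * f z) z - hankel u (\<lambda>z. \<phi> z * poly r z) z)
      \<le> D * L2_norm (\<lambda>z. f z - poly r z)"
  proof -
    have "(\<lambda>z. v z * (\<phi> z * f z - \<phi> z * poly r z)) \<in> L2"
      by (rule L2_bound[OF fr _ AEv]) measurable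
    from hankel_diff_le[OF u mult(1)[OF f] mult(1)[OF rdom] this[unfolded v_def]]
    have "L2_norm (\<lambda>z. hankel u (\<lambda>z. \<phi> z * f z) z - hankel u (\<lambda>z. \<phi> z * poly r z) z)
        \<le> L2_norm (\<lambda>z. v z * (\<phi> z * f z - \<phi> z * poly r z))"
      by (simp add: v_def)
    also have "\<dots> \<le> D * L2_norm (\<lambda>z. f z - poly r z)"
      by (rule L2_norm_mono[OF fr _ D0 AEv]) measurable
    finally show ?thesis .
  qed

  \<comment> \<open>From \<open>\<phi> * r\<close> to \<open>q * r\<close>: the polynomial \<open>r\<close> is bounded on the circle.\<close>
  obtain K where K: "0 \<le> K" "\<And>z. norm z = 1 \<Longrightarrow> norm (poly r z) \<le> K"
    by (rule poly_circle_bounded[of r]) (rule that)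
  have "(\<lambda>j. K * (L2_norm (\<lambda>z. poly (P k j) z - \<phi> z) + L2_norm (\<lambda>z. v z * (poly (P k j) z - \<phi> z))))
      \<longlonglongrightarrow> K * (0 + 0)"
    by (intro tendsto_intros limP)
  hence "\<forall>\<^sub>F j in sequentially. K * (L2_norm (\<lambda>z. poly (P k j) z - \<phi> z) +
      L2_norm (\<lambda>z. v z * (poly (P k j) z - \<phi> z))) < e / 3"
    using e by (intro order_tendstoD(2)) auto
  then obtain q where q: "K * (L2_norm (\<lambda>z. poly q z - \<phi> z) +
      L2_norm (\<lambda>z. v z * (poly q z - \<phi> z))) < e / 3"
    by (auto dest: eventually_happens)
  have qdom: "poly (q * r) \<in> hankel_dom u" by (rule poly_in_hankel_dom[OF u])
  have q\<phi>: "(\<lambda>z. poly q z - \<phi> z) \<in> L2" by (intro L2_diff L2_poly \<phi>)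
  have vq\<phi>: "(\<lambda>z. v z * (poly q z - \<phi> z)) \<in> L2"
    using L2_diff[OF L2_mult_poly[OF v, of q] v\<phi>] by (simp add: algebra_simps)
  have small: "norm (w * (\<phi> z * poly r z - poly (q * r) z)) \<le> K * norm (w * (poly q z - \<phi> z))"
    if "norm z = 1" for w z
  proof -
    have "norm (w * (\<phi> z * poly r z - poly (q * r) z)) = norm (poly r z * (w * (poly q z - \<phi> z)))"
      using norm_minus_cancel[of "poly r z * (w * (poly q z - \<phi> z))"] by (simp add: algebra_simps del: norm_minus_cancel)
    also have "\<dots> \<le> K * norm (w * (poly q z - \<phi> z))"
      unfolding norm_mult[of "poly r z"] by (intro mult_right_mono K that norm_ge_zero)
    finally show ?thesis .
  qed
  have d3: "L2_norm (\<lambda>z. \<phi> z * poly r z - poly (q * r) z) \<le> K * L2_norm (\<lambda>z. poly q z - \<phi> z)"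
  proof (rule L2_norm_mono[OF q\<phi> _ K(1)])
    show "AE z in \<mu>. norm (\<phi> z * poly r z - poly (q * r) z) \<le> K * norm (poly q z - \<phi> z)"
      by (rule AE_I2) (use small[of _ 1] in simp)
  qed measurable
  have AEq: "AE z in \<mu>. norm (v z * (\<phi> z * poly r z - poly (q * r) z))
      \<le> K * norm (v z * (poly q z - \<phi> z))"
    by (rule AE_I2) (rule small, simp)
  have h3: "L2_norm (\<lambda>z. hankel u (\<lambda>z. \<phi> z * poly r z) z - hankel u (poly (q * r)) z)
      \<le> K * L2_norm (\<lambda>z. v z * (poly q z - \<phi> z))"
  proof -
    have "(\<lambda>z. v z * (\<phi> z * poly r z - poly (q * r) z)) \<in> L2"
      by (rule L2_bound[OF vq\<phi> _ AEq]) measurable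
    from hankel_diff_le[OF u mult(1)[OF rdom] qdom this[unfolded v_def]]
    have "L2_norm (\<lambda>z. hankel u (\<lambda>z. \<phi> z * poly r z) z - hankel u (poly (q * r)) z)
        \<le> L2_norm (\<lambda>z. v z * (\<phi> z * poly r z - poly (q * r) z))"
      by (simp only: v_def)
    also have "\<dots> \<le> K * L2_norm (\<lambda>z. v z * (poly q z - \<phi> z))"
      by (rule L2_norm_mono[OF vq\<phi> _ K(1) AEq]) measurable
    finally show ?thesis .
  qed

  note doms = f mult(1)[OF f] mult(1)[OF rdom] qdom
  note L = doms[THEN hankel_dom_H2, THEN H2_L2] doms[THEN hankel_H2, THEN H2_L2]
  have "L2_norm (\<lambda>z. f z - poly (q * r) z) \<le> L2_norm (\<lambda>z. f z - \<phi> z * f z) +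
      (L2_norm (\<lambda>z. \<phi> z * f z - \<phi> z * poly r z) + L2_norm (\<lambda>z. \<phi> z * poly r z - poly (q * r) z))"
    using L2_norm_triangle_sub[OF L(1,2,4)] L2_norm_triangle_sub[OF L(2,3,4)] by linarith
  moreover have "L2_norm (\<lambda>z. hankel u f z - hankel u (poly (q * r)) z)
      \<le> L2_norm (\<lambda>z. hankel u f z - hankel u (\<lambda>z. \<phi> z * f z) z) +
      (L2_norm (\<lambda>z. hankel u (\<lambda>z. \<phi> z * f z) z - hankel u (\<lambda>z. \<phi> z * poly r z) z) +
       L2_norm (\<lambda>z. hankel u (\<lambda>z. \<phi> z * poly r z) z - hankel u (poly (q * r)) z))"
    using L2_norm_triangle_sub[OF L(5,6,8)] L2_norm_triangle_sub[OF L(6,7,8)] by linarith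
  ultimately have "L2_norm (\<lambda>z. f z - poly (q * r) z)
      + L2_norm (\<lambda>z. hankel u f z - hankel u (poly (q * r)) z) < e"
    using d1 h1 d2 h2 d3 h3 r q unfolding distrib_left distrib_right by linarith
  thus ?thesis by (rule that)
qed

section \<open>The adjoint\<close>

text \<open>
  Substituting the conjugate variable turns the defining integral of the coefficient into the
  conjugate of one for \<open>u * cnj g\<close>; this is where \<open>u\<^sup>#\<close> comes from.
\<close>

lemma hankel_coeff_sharp:
  assumes "u \<in> L2" "g \<in> L2"
  shows "hankel_coeff (sharp u) g n = cnj (fourier_coeff (\<lambda>z. u z * cnj (g z)) (int n))"
proof -
  have [measurable]: "u \<in> borel_measurable \<mu>" "g \<in> borel_measurable \<mu>"
    using assms L2_measurable by auto
  let ?k = "\<lambda>z. cnj (u z) * g z * (cnj z) powi (- int n)"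
  have "?k = (\<lambda>z. cnj (u z) * g z * cnj (z powi (- int n)))" by simp
  moreover have "\<dots> \<in> borel_measurable \<mu>" by measurable
  ultimately have meas: "?k \<in> borel_measurable \<mu>" by simp
  have "hankel_coeff (sharp u) g n = (LINT z|\<mu>. ?k (cnj z))"
    by (simp add: fourier_coeff_def sharp_def refl_J_def del: power_int_minus)
  also have "\<dots> = (LINT z|\<mu>. ?k z)" by (rule integral_cnj_circle[OF meas])
  also have "\<dots> = (LINT z|\<mu>. cnj (u z * cnj (g z) * z powi (- int n)))" by simp
  also have "\<dots> = cnj (LINT z|\<mu>. u z * cnj (g z) * z powi (- int n))"
    by (rule Bochner_Integration.integral_cnj)
  finally show ?thesis by (simp add: fourier_coeff_def)
qed

lemma L2_inner_hankel_poly: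
  assumes "u \<in> L2" "g \<in> H2"
  shows "L2_inner (hankel u (poly p)) g =
    (\<Sum>i\<le>degree p. coeff p i * cnj (hankel_coeff (sharp u) g i))"
proof -
  note gL = H2_L2[OF assms(2)] and p = poly_in_hankel_dom[OF assms(1), of p]
  have int: "integrable \<mu> (\<lambda>z. u z * cnj (g z))"
    by (intro L2_mult_integrable L2_cnj assms gL)
  have "(\<lambda>z. poly p z * refl_J u z) \<in> L2" by (intro L2_mult_poly L2_refl_J assms)
  from L2_refl_J[OF this] have L: "(\<lambda>z. u z * refl_J (poly p) z) \<in> L2"
    by (simp add: refl_J_def[abs_def] mult.commute)
  have "L2_inner (hankel u (poly p)) g = L2_inner (\<lambda>z. u z * refl_J (poly p) z) g"
    by (rule L2_inner_analytic_part[OF H2_L2[OF hankel_H2[OF p]] L assms(2) fourier_coeff_hankel[OF p]])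
  also have "\<dots> = fourier_coeff (\<lambda>z. refl_J (poly p) z * (u z * cnj (g z))) 0"
    by (simp add: L2_inner_def fourier_coeff_def mult_ac)
  also have "\<dots> = (\<Sum>i\<le>degree p. coeff p i * cnj (hankel_coeff (sharp u) g i))"
    by (simp add: fourier_coeff_mult_refl_J_poly[OF int] hankel_coeff_sharp[OF assms(1) gL])
  finally show ?thesis .
qed

lemma L2_inner_poly_left:
  "w \<in> L2 \<Longrightarrow> L2_inner (poly p) w = (\<Sum>i\<le>degree p. coeff p i * cnj (fourier_coeff w (int i)))"
  by (subst L2_inner_commute) (simp add: L2_inner_poly_right)

text \<open>
  For polynomials both sides are the same finite sum.  Approximating \<open>f\<close> by polynomials in the graph
  norm makes both sides converge.
\<close>

theorem hankel_adjoint_pairing: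
  assumes u: "u \<in> L2" and f: "f \<in> hankel_dom u" and g: "g \<in> hankel_dom (sharp u)"
  shows "L2_inner (hankel u f) g = L2_inner f (hankel (sharp u) g)"
proof -
  let ?w = "hankel (sharp u) g"
  note gL = H2_L2[OF hankel_dom_H2[OF g]] and wL = H2_L2[OF hankel_H2[OF g]]
  have "\<exists>p. L2_norm (\<lambda>z. f z - poly p z) + L2_norm (\<lambda>z. hankel u f z - hankel u (poly p) z)
      < inverse (real (Suc j))" for j
    by (rule hankel_polynomials_dense[OF u f, of "inverse (real (Suc j))"]) auto
  then obtain p where p: "\<And>j. L2_norm (\<lambda>z. f z - poly (p j) z)
      + L2_norm (\<lambda>z. hankel u f z - hankel u (poly (p j)) z) < inverse (real (Suc j))"
    by metis
  have "(\<lambda>j. L2_norm (\<lambda>z. poly (p j) z - f z)) \<longlonglongrightarrow> 0"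
  proof (rule Lim_null_comparison[OF _ LIMSEQ_inverse_real_of_nat], rule always_eventually, rule allI)
    show "norm (L2_norm (\<lambda>z. poly (p j) z - f z)) \<le> inverse (real (Suc j))" for j
      using p[of j] L2_norm_nonneg[of "\<lambda>z. hankel u f z - hankel u (poly (p j)) z"]
        L2_norm_nonneg[of "\<lambda>z. poly (p j) z - f z"]
      unfolding L2_norm_minus_commute[of f "poly (p j)"] real_norm_def by linarith
  qed
  from L2_inner_tendsto_left[OF L2_poly H2_L2[OF hankel_dom_H2[OF f]] wL this]
  have 1: "(\<lambda>j. L2_inner (poly (p j)) ?w) \<longlonglongrightarrow> L2_inner f ?w" .
  have "(\<lambda>j. L2_norm (\<lambda>z. hankel u (poly (p j)) z - hankel u f z)) \<longlonglongrightarrow> 0"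
  proof (rule Lim_null_comparison[OF _ LIMSEQ_inverse_real_of_nat], rule always_eventually, rule allI)
    show "norm (L2_norm (\<lambda>z. hankel u (poly (p j)) z - hankel u f z)) \<le> inverse (real (Suc j))" for j
      using p[of j] L2_norm_nonneg[of "\<lambda>z. f z - poly (p j) z"]
        L2_norm_nonneg[of "\<lambda>z. hankel u (poly (p j)) z - hankel u f z"]
      unfolding L2_norm_minus_commute[of "hankel u f" "hankel u (poly (p j))"] real_norm_def
      by linarith
  qed
  from L2_inner_tendsto_left[OF H2_L2[OF hankel_H2[OF poly_in_hankel_dom[OF u]]]
      H2_L2[OF hankel_H2[OF f]] gL this]
  have 2: "(\<lambda>j. L2_inner (hankel u (poly (p j))) g) \<longlonglongrightarrow> L2_inner (hankel u f) g" .
  have "L2_inner (hankel u (poly (p j))) g = L2_inner (poly (p j)) ?w" for j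
    by (simp add: L2_inner_hankel_poly[OF u hankel_dom_H2[OF g]] L2_inner_poly_left[OF wL]
        fourier_coeff_hankel[OF g])
  with 1 2 show ?thesis using LIMSEQ_unique by simp
qed

text \<open>
  Testing the pairing on \<open>z ^ n\<close> alone identifies the coefficients of \<open>w\<close>.  Hence the vector in the
  definition of the adjoint is determined almost everywhere.
\<close>

lemma
  assumes u: "u \<in> L2" and g: "g \<in> H2" and w: "w \<in> H2"
    and pairing: "\<forall>f\<in>hankel_dom u. L2_inner (hankel u f) g = L2_inner f w"
  shows hankel_dom_sharp_of_pairing: "g \<in> hankel_dom (sharp u)"
    and hankel_sharp_of_pairing: "AE z in \<mu>. hankel (sharp u) g z = w z"
proof -
  have c: "hankel_coeff (sharp u) g n = fourier_coeff w (int n)" for n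
  proof -
    let ?p = "monom (1 :: complex) n"
    have d: "degree ?p = n" by (simp add: degree_monom_eq)
    have s: "(\<Sum>i\<le>n. coeff ?p i * x i) = x n" for x :: "nat \<Rightarrow> complex"
    proof -
      have "(\<Sum>i\<le>n. coeff ?p i * x i) = (\<Sum>i\<le>n. if i = n then x n else 0)"
        by (intro sum.cong) auto
      thus ?thesis by simp
    qed
    have "L2_inner (hankel u (poly ?p)) g = L2_inner (poly ?p) w"
      using pairing poly_in_hankel_dom[OF u] by blast
    thus ?thesis
      unfolding L2_inner_hankel_poly[OF u g] L2_inner_poly_left[OF H2_L2[OF w]] d s by simp
  qed
  show "g \<in> hankel_dom (sharp u)" by (rule hankel_domI[OF g H2_L2[OF w] c])
  thus "AE z in \<mu>. hankel (sharp u) g z = w z" by (rule hankel_AE_eqI[OF _ w c])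
qed

theorem hankel_adjoint_dom:
  assumes "u \<in> L2"
  shows "adjoint_dom (hankel_dom u) (hankel u) = hankel_dom (sharp u)"
proof (intro equalityI subsetI)
  fix g assume "g \<in> adjoint_dom (hankel_dom u) (hankel u)"
  thus "g \<in> hankel_dom (sharp u)"
    unfolding adjoint_dom_def using hankel_dom_sharp_of_pairing[OF assms] by blast
next
  fix g assume g: "g \<in> hankel_dom (sharp u)"
  thus "g \<in> adjoint_dom (hankel_dom u) (hankel u)"
    unfolding adjoint_dom_def
    using hankel_dom_H2[OF g] hankel_H2[OF g] hankel_adjoint_pairing[OF assms _ g] by blast
qed

theorem hankel_adjoint_op:
  assumes "u \<in> L2" "g \<in> hankel_dom (sharp u)"
  shows "AE z in \<mu>. adjoint_op (hankel_dom u) (hankel u) g z = hankel (sharp u) g z"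
proof -
  let ?w = "adjoint_op (hankel_dom u) (hankel u) g"
  have "\<exists>w. w \<in> H2 \<and> (\<forall>f\<in>hankel_dom u. L2_inner (hankel u f) g = L2_inner f w)"
    using hankel_H2[OF assms(2)] hankel_adjoint_pairing[OF assms(1) _ assms(2)] by blast
  hence w: "?w \<in> H2 \<and> (\<forall>f\<in>hankel_dom u. L2_inner (hankel u f) g = L2_inner f ?w)"
    unfolding adjoint_op_def by (rule someI_ex)
  have "AE z in \<mu>. hankel (sharp u) g z = ?w z"
    by (rule hankel_sharp_of_pairing[OF assms(1) hankel_dom_H2[OF assms(2)]]) (use w in auto)
  thus ?thesis by eventually_elim simp
qed

theorem theorem1p1:
  fixes u :: "complex \<Rightarrow> complex"
  assumes "u \<in> H2"
  shows "(closed_operator (hankel_dom u) (hankel u) \<and>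
          graph_norm_complete (hankel_dom u) (hankel u)) \<and>
         ((\<forall>p :: complex poly. poly p \<in> hankel_dom u) \<and>
          (\<forall>f \<in> hankel_dom u. \<forall>e>0. \<exists>p :: complex poly.
             graph_norm (hankel u) (\<lambda>z. f z - poly p z) < e)) \<and>
         (adjoint_dom (hankel_dom u) (hankel u) = hankel_dom (sharp u) \<and>
          (\<forall>g \<in> hankel_dom (sharp u). AE z in circle_measure.
             adjoint_op (hankel_dom u) (hankel u) g z = hankel (sharp u) g z))"
proof -
  have u: "u \<in> L2" by (rule H2_L2[OF assms])
  have dense: "\<exists>p :: complex poly. graph_norm (hankel u) (\<lambda>z. f z - poly p z) < e"
    if f: "f \<in> hankel_dom u" and e: "e > 0" for f e
  proof -
    obtain p where "L2_norm (\<lambda>z. f z - poly p z)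
        + L2_norm (\<lambda>z. hankel u f z - hankel u (poly p) z) < e"
      by (rule hankel_polynomials_dense[OF u f e])
    with graph_norm_le[of "hankel u" "\<lambda>z. f z - poly p z"]
      L2_norm_hankel_diff[OF u f poly_in_hankel_dom[OF u], of p]
    have "graph_norm (hankel u) (\<lambda>z. f z - poly p z) < e" by simp
    thus ?thesis by blast
  qed
  show ?thesis
    using hankel_closed[OF u] hankel_graph_norm_complete[OF u] poly_in_hankel_dom[OF u] dense
      hankel_adjoint_dom[OF u] hankel_adjoint_op[OF u] by blast
qed

end
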